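(* Let $(f_\beta)_{\beta\in[0,\infty)}$ be the family of skew products described in the context, where $\Theta$ is a compact metric space, $\gamma:\Theta\to\Theta$ is a homeomorphism, $A:\Theta\to \mathrm{SL}(2,\mathbb{R})$ is continuous, and $h:[0,\infty)\to[0,\infty)$ is $\mathcal{C}^2$, strictly increasing, strictly concave, bounded, with $h(0)=0$, $h'(0)=1$ and $\sup_{x\ge 0}h(x)\le \left(\max_{\theta\in\Theta}\|A(\theta)\|\right)^{-1}$. Let $\beta_1:=e^{-\lambda_{\max}(A)}$ and $\beta_2:=e^{\lambda_{\max}(A)}$. Then the following hold. (a) If $\beta<\beta_1$, then the global attractor $\mathcal{A}_\beta$ is equal to $\Theta\times\{0\}$. (b) If $\beta_1<\beta<\beta_2$, then there exists at least one $\theta^*\in\Theta$ such that $\mathcal{A}_\beta(\theta^* )$ is a line segment of positive length. (c) If $\beta>\beta_2$, then for all $\theta\in\Theta$ the set $\mathcal{A}_\beta(\theta)$ is a closed topological disk (i.e. homeomorphic to the closed unit disk) and depends continuously on $\theta$; in other words, the function $r_\beta$ is strictly positive and continuous on $\Theta\times\mathbb{R}$. Further, the compact $f_\beta$-invariant set $$\mathcal{T}_\beta=\partial\mathcal{A}_\beta=\left\{\left(\theta,r_\beta(\theta,\alpha)v(\alpha)\right)\mid \theta\in\Theta,\ \alpha\in[0,1)\right\}$$ is the global attractor outside $\Theta\times\{0\}$, in the sense that $$\mathcal{T}_\beta=\bigcap_{n\in\mathbb{N}} f_\beta^n\left(\Theta\times\left(\overline{B_1(0)}\setminus B_\delta(0)\right)\right)$$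 for all sufficiently small $\delta>0$.
   Context: For $\beta\in[0,\infty)$ the map $f_\beta:\Theta\times\mathbb{R}^2\to\Theta\times\mathbb{R}^2$ is $f_\beta(\theta,v)=(\gamma(\theta),f_{\beta,\theta}(v))$ with $f_{\beta,\theta}(v)=h(\beta\|v\|)\,A(\theta)\frac{v}{\|v\|}$ if $v\neq0$ and $f_{\beta,\theta}(0)=0$; $\|\cdot\|$ is the Euclidean norm on $\mathbb{R}^2$ and the induced operator norm on matrices. $B_\delta(0)$ is the open ball of radius $\delta$ about $0$ in $\mathbb{R}^2$. The bound on $\sup h$ gives $f_\beta(\Theta\times\mathbb{R}^2)\subseteq\Theta\times\overline{B_1(0)}$, and the global attractor is $\mathcal{A}_\beta=\bigcap_{n\in\mathbb{N}}f_\beta^n(\Theta\times\overline{B_1(0)})$. Write $\mathcal{A}_\beta(\theta)=\{x\in\mathbb{R}^2\mid(\theta,x)\in\mathcal{A}_\beta\}$ and $v(\alpha)=(\cos 2\pi\alpha,\sin2\pi\alpha)^t$. The global attractor has the form $\mathcal{A}_\beta=\{(\theta,rv(\alpha))\mid\theta\in\Theta,\alpha\in[0,1),r\in[0,r_\beta(\theta,\alpha)]\}$, where $r_\beta:\Theta\times\mathbb{R}\to[0,1]$, $r_\beta(\theta,\alpha)=\max\{r\ge0\mid rv(\alpha)\in\mathcal{A}_\beta(\theta)\}$, is upper semi-continuous and $\frac12$-periodic in $\alpha$. The maximal Lyapunov exponent is $\lambda_{\max}(A)=\sup_{\theta\in\Theta}\limsup_{n\to\infty}\frac1n\log\|A_n(\theta)\|$,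 where $A_n(\theta)=A(\gamma^{n-1}\theta)\cdots A(\gamma\theta)A(\theta)$. *)

theory Defs
  imports "HOL-Analysis.Analysis"
begin

definition strictly_concave_on :: "real set \<Rightarrow> (real \<Rightarrow> real) \<Rightarrow> bool" where
  "strictly_concave_on S h \<longleftrightarrow> convex S \<and>
     (\<forall>x\<in>S. \<forall>y\<in>S. \<forall>t. x \<noteq> y \<and> 0 < t \<and> t < 1 \<longrightarrow>
        (1 - t) * h x + t * h y < h ((1 - t) * x + t * y))"

text \<open>Derivatives are taken within \<open>S\<close>, hence one-sided at the endpoints of an interval.\<close>
definition C2_on :: "real set \<Rightarrow> (real \<Rightarrow> real) \<Rightarrow> bool" where
  "C2_on S h \<longleftrightarrow> (\<exists>h' h''.
     (\<forall>x\<in>S. (h has_real_derivative h' x) (at x within S)) \<and>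
     (\<forall>x\<in>S. (h' has_real_derivative h'' x) (at x within S)) \<and>
     continuous_on S h'')"

abbreviation matrix_norm :: "real^2^2 \<Rightarrow> real" where
  "matrix_norm M \<equiv> onorm ((*v) M)"

primrec cocycle :: "('a \<Rightarrow> 'a) \<Rightarrow> ('a \<Rightarrow> real^2^2) \<Rightarrow> nat \<Rightarrow> 'a \<Rightarrow> real^2^2" where
  "cocycle \<gamma> A 0 \<theta> = mat 1"
| "cocycle \<gamma> A (Suc n) \<theta> = A ((\<gamma> ^^ n) \<theta>) ** cocycle \<gamma> A n \<theta>"

text \<open>The upper limits and the supremum are formed in the extended reals. For a continuous
  \<open>SL(2,\<real>)\<close>-cocycle over a nonempty compact space the value lies between \<open>0\<close> and the logarithm of
  the maximal norm of \<open>A\<close>, so converting it back to a real number loses nothing.\<close>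
definition lyapunov_max :: "('a \<Rightarrow> 'a) \<Rightarrow> ('a \<Rightarrow> real^2^2) \<Rightarrow> real" where
  "lyapunov_max \<gamma> A = real_of_ereal
     (SUP \<theta>. limsup (\<lambda>n. ereal (1 / real n * ln (matrix_norm (cocycle \<gamma> A n \<theta>)))))"

definition fibre_map :: "('a \<Rightarrow> real^2^2) \<Rightarrow> (real \<Rightarrow> real) \<Rightarrow> real \<Rightarrow> 'a \<Rightarrow> real^2 \<Rightarrow> real^2" where
  "fibre_map A h \<beta> \<theta> v =
     (if v = 0 then 0 else h (\<beta> * norm v) *\<^sub>R (A \<theta> *v (v /\<^sub>R norm v)))"

definition skew_product ::
  "('a \<Rightarrow> 'a) \<Rightarrow> ('a \<Rightarrow> real^2^2) \<Rightarrow> (real \<Rightarrow> real) \<Rightarrow> real \<Rightarrow> 'a \<times> (real^2) \<Rightarrow> 'a \<times> (real^2)" where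
  "skew_product \<gamma> A h \<beta> = (\<lambda>(\<theta>, v). (\<gamma> \<theta>, fibre_map A h \<beta> \<theta> v))"

definition attractor ::
  "('a \<Rightarrow> 'a) \<Rightarrow> ('a \<Rightarrow> real^2^2) \<Rightarrow> (real \<Rightarrow> real) \<Rightarrow> real \<Rightarrow> ('a \<times> (real^2)) set" where
  "attractor \<gamma> A h \<beta> = (\<Inter>n. (skew_product \<gamma> A h \<beta> ^^ n) ` (UNIV \<times> cball 0 1))"

definition attractor_fibre ::
  "('a \<Rightarrow> 'a) \<Rightarrow> ('a \<Rightarrow> real^2^2) \<Rightarrow> (real \<Rightarrow> real) \<Rightarrow> real \<Rightarrow> 'a \<Rightarrow> (real^2) set" where
  "attractor_fibre \<gamma> A h \<beta> \<theta> = {x. (\<theta>, x) \<in> attractor \<gamma> A h \<beta>}"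

definition unit_vec :: "real \<Rightarrow> real^2" where
  "unit_vec \<alpha> = vector [cos (2 * pi * \<alpha>), sin (2 * pi * \<alpha>)]"

definition radius ::
  "('a \<Rightarrow> 'a) \<Rightarrow> ('a \<Rightarrow> real^2^2) \<Rightarrow> (real \<Rightarrow> real) \<Rightarrow> real \<Rightarrow> 'a \<Rightarrow> real \<Rightarrow> real" where
  "radius \<gamma> A h \<beta> \<theta> \<alpha> =
     (GREATEST r. 0 \<le> r \<and> r *\<^sub>R unit_vec \<alpha> \<in> attractor_fibre \<gamma> A h \<beta> \<theta>)"

definition boundary_torus ::
  "('a::metric_space \<Rightarrow> 'a) \<Rightarrow> ('a \<Rightarrow> real^2^2) \<Rightarrow> (real \<Rightarrow> real) \<Rightarrow> real \<Rightarrow> ('a \<times> (real^2)) set" where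
  "boundary_torus \<gamma> A h \<beta> = frontier (attractor \<gamma> A h \<beta>)"

text \<open>Continuity of a set-valued map with respect to the Hausdorff distance.\<close>
definition hausdorff_continuous :: "('a::metric_space \<Rightarrow> 'b::metric_space set) \<Rightarrow> bool" where
  "hausdorff_continuous K \<longleftrightarrow> (\<forall>\<theta>. \<forall>\<epsilon>>0. \<forall>\<^sub>F \<theta>' in at \<theta>.
     K \<theta>' \<subseteq> (\<Union>x\<in>K \<theta>. ball x \<epsilon>) \<and> K \<theta> \<subseteq> (\<Union>x\<in>K \<theta>'. ball x \<epsilon>))"

end

theory Submission
  imports Defs
begin

text \<open>
  Every fibre map sends rays to rays, so the \<open>n\<close>-th image of \<open>\<Theta> \<times> cball 0 1\<close> is the region below the
  graph of a radial function \<open>rho 1 n\<close>, and the attractor is the region below their decreasing limit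
  \<open>envelope\<close>. A point of the attractor has all its preimages in the unit ball, which bounds
  \<open>norm (A\<^sub>n\<^sup>-\<^sup>1 w)\<close> by \<open>\<beta>\<^sup>n\<close>; conversely, since \<open>h\<close> has slope \<open>1\<close> at \<open>0\<close>, the bound
  \<open>norm (A\<^sub>n\<^sup>-\<^sup>1 w) \<le> K b\<^sup>n\<close> with \<open>b < \<beta>\<close> keeps \<open>envelope \<theta> w\<close> away from \<open>0\<close>.

  For (a) and (c) one uses that \<open>norm A\<^sub>n = norm A\<^sub>n\<^sup>-\<^sup>1\<close> grows at rate at most \<open>\<lambda>\<close>, uniformly in \<open>\<theta>\<close>.
  For (b), compactness yields a direction contracted at rate \<open>k < \<lambda>\<close> in backward time by every \<open>A\<^sub>n\<^sup>-\<^sup>1\<close>;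
  as areas are preserved, all other directions are expanded too fast to meet the attractor.
  In (c), strict concavity of \<open>h\<close> makes the graph transform contract quotients of radial functions, so
  \<open>rho 1 n\<close> and \<open>rho \<delta> n\<close> converge uniformly to \<open>envelope\<close>, which is therefore continuous.
\<close>

section \<open>Planar linear algebra\<close>

text \<open>The signed area of the parallelogram spanned by \<open>x\<close> and \<open>y\<close>.
  Matrices of determinant 1 preserve it.\<close>

definition wedge :: "real^2 \<Rightarrow> real^2 \<Rightarrow> real" where
  "wedge x y = x$1 * y$2 - x$2 * y$1"

text \<open>The adjugate, which is the inverse when \<open>det M = 1\<close>. Its entries are
  entries of \<open>M\<close> up to sign, so continuity in \<open>M\<close> is immediate.\<close>

definition adj2 :: "real^2^2 \<Rightarrow> real^2^2" where
  "adj2 M = vector [vector [M$2$2, - M$1$2], vector [- M$2$1, M$1$1]]"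

lemma matrix_vector_mult_2:
  fixes M :: "real^2^2"
  shows "(M *v x)$1 = M$1$1 * x$1 + M$1$2 * x$2" "(M *v x)$2 = M$2$1 * x$1 + M$2$2 * x$2"
  by (simp_all add: matrix_vector_mult_def sum_2)

lemma norm_sq_2: "(norm (x::real^2))\<^sup>2 = (x$1)\<^sup>2 + (x$2)\<^sup>2"
  unfolding power2_norm_eq_inner by (simp add: inner_vec_def sum_2 power2_eq_square)

lemma wedge_mult: "wedge (M *v x) (M *v y) = det M * wedge x y"
  by (simp add: wedge_def matrix_vector_mult_2 det_2 algebra_simps)

text \<open>Lagrange's identity: the squares of the wedge and of the inner product add up to the
  square of \<open>norm x * norm y\<close>.\<close>

lemma wedge_le: "\<bar>wedge x y\<bar> \<le> norm x * norm y"
proof (rule power2_le_imp_le)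
  have "(wedge x y)\<^sup>2 + (x$1 * y$1 + x$2 * y$2)\<^sup>2 = (norm x * norm y)\<^sup>2"
    unfolding power_mult_distrib norm_sq_2 wedge_def by algebra
  then show "\<bar>wedge x y\<bar>\<^sup>2 \<le> (norm x * norm y)\<^sup>2"
    using zero_le_power2[of "x$1 * y$1 + x$2 * y$2"] by (simp only: power2_abs)
qed simp

text \<open>In the orthonormal basis formed by \<open>u\<close> and its quarter turn, the second
  coordinate of \<open>x\<close> is \<open>wedge u x\<close>.\<close>

lemma wedge_zero_parallel:
  assumes "wedge u x = 0" "norm u = 1"
  shows "x = (u \<bullet> x) *\<^sub>R u"
proof -
  have u: "(u$1)\<^sup>2 + (u$2)\<^sup>2 = 1" using assms norm_sq_2[of u] by simp
  have w: "u$1 * x$2 = u$2 * x$1" using assms by (simp add: wedge_def)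
  have "x$1 = (u$1 * x$1 + u$2 * x$2) * u$1" "x$2 = (u$1 * x$1 + u$2 * x$2) * u$2"
    using u w by algebra+
  then show ?thesis
    by (simp add: vec_eq_iff forall_2 inner_vec_def sum_2)
qed

lemma adj2_mult:
  assumes "det M = 1"
  shows "M *v (adj2 M *v x) = x" "adj2 M *v (M *v x) = x"
proof -
  have "M$1$1 * M$2$2 = 1 + M$1$2 * M$2$1" using assms by (simp add: det_2)
  then show "M *v (adj2 M *v x) = x" "adj2 M *v (M *v x) = x"
    unfolding vec_eq_iff forall_2 matrix_vector_mult_2 adj2_def vector_2 by algebra+
qed

lemma norm_mult_le: "norm (M *v x) \<le> matrix_norm M * norm (x::real^2)"
  for M :: "real^2^2"
  by (rule onorm) simp

lemma matrix_norm_nonneg: "0 \<le> matrix_norm M" for M :: "real^2^2"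
  by (rule onorm_pos_le) simp

text \<open>Area preservation bounds the inverse by \<open>M\<close> itself. The preimage
  \<open>x\<close> of \<open>w\<close> and its quarter turn \<open>Jx\<close> span area
  \<open>(norm x)^2\<close>; their images \<open>w\<close> and \<open>M *v Jx\<close> span the same
  area, which is at most \<open>norm w * matrix_norm M * norm x\<close>.\<close>

lemma norm_adj2_mult_le:
  assumes "det M = 1"
  shows "norm (adj2 M *v w) \<le> matrix_norm M * norm w"
proof -
  define x where "x = adj2 M *v w"
  define Jx :: "real^2" where "Jx = vector [- x$2, x$1]"
  have n: "norm Jx = norm x"
    by (rule power2_eq_imp_eq) (simp_all add: norm_sq_2 Jx_def)
  have "(norm x)\<^sup>2 = wedge x Jx"
    unfolding norm_sq_2 by (simp add: wedge_def Jx_def power2_eq_square)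
  also have "\<dots> = wedge (M *v x) (M *v Jx)" using assms by (simp add: wedge_mult)
  also have "\<dots> = wedge w (M *v Jx)" using assms by (simp add: x_def adj2_mult)
  also have "\<dots> \<le> norm w * norm (M *v Jx)" using wedge_le[of w "M *v Jx"] by linarith
  also have "\<dots> \<le> norm w * (matrix_norm M * norm x)"
    using norm_mult_le[of M Jx] by (intro mult_left_mono) (simp_all add: n)
  finally have "norm x * norm x \<le> norm x * (matrix_norm M * norm w)"
    by (simp add: power2_eq_square algebra_simps)
  then show ?thesis
    unfolding x_def[symmetric]
    by (cases "norm x = 0") (auto simp: mult_le_cancel_left matrix_norm_nonneg)
qed

text \<open>The identity factors through \<open>M\<close> and its inverse, and the norm of the
  inverse is at most that of \<open>M\<close>.\<close>

lemma matrix_norm_ge_1: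
  assumes "det M = 1"
  shows "1 \<le> matrix_norm M"
proof -
  define u :: "real^2" where "u = axis 1 1"
  have u: "norm u = 1" by (simp add: u_def)
  have "1 = norm (M *v (adj2 M *v u))" using assms u by (simp add: adj2_mult)
  also have "\<dots> \<le> matrix_norm M * norm (adj2 M *v u)" by (rule norm_mult_le)
  also have "\<dots> \<le> matrix_norm M * (matrix_norm M * 1)"
    using norm_adj2_mult_le[OF assms, of u] u by (intro mult_left_mono) (auto simp: matrix_norm_nonneg)
  finally have "1 \<le> (matrix_norm M)\<^sup>2" by (simp add: power2_eq_square)
  then show ?thesis using matrix_norm_nonneg[of M]
    using power2_le_imp_le[of 1 "matrix_norm M"] by simp
qed

lemma matrix_norm_mult_le: "matrix_norm (M ** N) \<le> matrix_norm M * matrix_norm N"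
  for M N :: "real^2^2"
proof (rule onorm_le)
  fix x
  have "norm (M ** N *v x) = norm (M *v (N *v x))" by (simp add: matrix_vector_mul_assoc)
  also have "\<dots> \<le> matrix_norm M * (matrix_norm N * norm x)"
    by (rule order.trans[OF norm_mult_le mult_left_mono[OF norm_mult_le matrix_norm_nonneg]])
  finally show "norm (M ** N *v x) \<le> matrix_norm M * matrix_norm N * norm x" by simp
qed

text \<open>By the triangle inequality the operator norms of two matrices differ by at most the norm
  of their difference, which the sum of its absolute entries dominates.\<close>

lemma continuous_matrix_norm:
  fixes F :: "'a::topological_space \<Rightarrow> real^2^2"
  assumes "continuous_on S F"
  shows "continuous_on S (\<lambda>x. matrix_norm (F x))"
  unfolding continuous_on_def
proof
  fix x assume x: "x \<in> S"
  have lim: "((\<lambda>y. \<Sum>i\<in>UNIV. \<Sum>j\<in>UNIV. \<bar>(F y - F x) $ i $ j\<bar>) \<longlongrightarrow>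
      (\<Sum>i\<in>UNIV. \<Sum>j\<in>UNIV. \<bar>(F x - F x) $ i $ j\<bar>)) (at x within S)"
    using assms x unfolding continuous_on_def by (intro tendsto_intros) auto
  have le: "\<bar>matrix_norm M - matrix_norm N\<bar> \<le> (\<Sum>i\<in>UNIV. \<Sum>j\<in>UNIV. \<bar>(M - N) $ i $ j\<bar>)"
    for M N :: "real^2^2"
  proof -
    have 1: "matrix_norm P \<le> matrix_norm Q + matrix_norm (P - Q)" for P Q :: "real^2^2"
    proof (rule onorm_le)
      fix x
      have "norm (P *v x) = norm (Q *v x + (P - Q) *v x)"
        by (simp add: matrix_vector_mult_diff_rdistrib)
      also have "\<dots> \<le> matrix_norm Q * norm x + matrix_norm (P - Q) * norm x"
        by (rule norm_triangle_le[OF add_mono[OF norm_mult_le norm_mult_le]])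
      finally show "norm (P *v x) \<le> (matrix_norm Q + matrix_norm (P - Q)) * norm x"
        by (simp add: algebra_simps)
    qed
    have 2: "matrix_norm (N - M) \<le> matrix_norm (M - N)"
    proof (rule onorm_le)
      fix x
      have "norm ((N - M) *v x) = norm ((M - N) *v x)"
        by (simp add: matrix_vector_mult_diff_rdistrib norm_minus_commute)
      then show "norm ((N - M) *v x) \<le> matrix_norm (M - N) * norm x"
        using norm_mult_le[of "M - N" x] by simp
    qed
    show ?thesis
      using 1[of M N] 1[of N M] 2 onorm_le_matrix_component_sum[of "M - N"] by linarith
  qed
  show "((\<lambda>y. matrix_norm (F y)) \<longlongrightarrow> matrix_norm (F x)) (at x within S)"
  proof (rule Lim_transform2)
    show "((\<lambda>y. matrix_norm (F x)) \<longlongrightarrow> matrix_norm (F x)) (at x within S)" by simp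
    show "((\<lambda>y. matrix_norm (F x) - matrix_norm (F y)) \<longlongrightarrow> 0) (at x within S)"
    proof (rule Lim_null_comparison[OF always_eventually])
      show "\<forall>y. norm (matrix_norm (F x) - matrix_norm (F y)) \<le>
          (\<Sum>i\<in>UNIV. \<Sum>j\<in>UNIV. \<bar>(F y - F x) $ i $ j\<bar>)"
        using le[of "F y" "F x" for y] by (auto simp: abs_minus_commute)
    qed (use lim in simp)
  qed
qed

lemma continuous_on_mult_vec:
  fixes F :: "'a::topological_space \<Rightarrow> real^2^2"
  assumes "continuous_on S F" "continuous_on S g"
  shows "continuous_on S (\<lambda>x. F x *v g x)"
  unfolding matrix_vector_mult_def
  by (intro continuous_intros continuous_on_vec_lambda assms)

lemma continuous_on_adj2:
  assumes "continuous_on S F"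
  shows "continuous_on S (\<lambda>x. adj2 (F x))"
proof -
  have eq: "adj2 M = (\<chi> i j. (if i = 1 then (if j = 1 then M$2$2 else - M$1$2)
      else (if j = 1 then - M$2$1 else M$1$1)))" for M
    by (simp add: adj2_def vec_eq_iff forall_2)
  show ?thesis
    unfolding eq
    apply (intro continuous_on_vec_lambda)
    subgoal for i j by (cases "i = 1"; cases "j = 1") (auto intro!: continuous_intros assms)
    done
qed

lemma continuous_on_matrix_mult:
  fixes F G :: "'b::topological_space \<Rightarrow> real^2^2"
  assumes "continuous_on S F" "continuous_on S G"
  shows "continuous_on S (\<lambda>x. F x ** G x)"
  unfolding matrix_matrix_mult_def
  by (intro continuous_intros continuous_on_vec_lambda assms)

section \<open>Growth of the cocycle\<close>

locale sl2_cocycle =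
  fixes \<gamma> \<gamma>' :: "'a::metric_space \<Rightarrow> 'a" and A :: "'a \<Rightarrow> real^2^2"
  assumes compact_UNIV: "compact (UNIV :: 'a set)"
    and homeo: "homeomorphism UNIV UNIV \<gamma> \<gamma>'"
    and cont_A: "continuous_on UNIV A"
    and det_A: "det (A \<theta>) = 1"
begin

lemma inv_simps [simp]: "\<gamma>' (\<gamma> \<theta>) = \<theta>" "\<gamma> (\<gamma>' \<theta>) = \<theta>"
  using homeo by (auto simp: homeomorphism_def)

lemma cont_\<gamma>: "continuous_on UNIV \<gamma>" and cont_\<gamma>': "continuous_on UNIV \<gamma>'"
  using homeo by (auto simp: homeomorphism_def)

definition bound :: real where
  "bound = (SUP \<theta>. matrix_norm (A \<theta>))"

lemma matrix_norm_le_bound: "matrix_norm (A \<theta>) \<le> bound"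
proof -
  have "compact (range (\<lambda>\<theta>. matrix_norm (A \<theta>)))"
    by (rule compact_continuous_image[OF continuous_matrix_norm[OF cont_A] compact_UNIV])
  then have "bdd_above (range (\<lambda>\<theta>. matrix_norm (A \<theta>)))"
    by (intro bounded_imp_bdd_above compact_imp_bounded)
  then show ?thesis unfolding bound_def by (intro cSUP_upper) auto
qed

lemma bound_ge_1: "1 \<le> bound"
  using matrix_norm_ge_1[OF det_A] matrix_norm_le_bound order_trans by blast

lemma det_cocycle: "det (cocycle \<gamma> A n \<theta>) = 1"
  by (induction n) (simp_all add: det_mul det_A)

lemma continuous_on_iterate: "continuous_on UNIV (\<gamma> ^^ n)"
proof (induction n)
  case (Suc n)
  then show ?case
    using continuous_on_compose2[OF cont_\<gamma> Suc] by (simp add: o_def)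
qed (simp add: id_def)

lemma continuous_on_cocycle: "continuous_on UNIV (cocycle \<gamma> A n)"
proof (induction n)
  case (Suc n)
  have "continuous_on UNIV (\<lambda>\<theta>. A ((\<gamma> ^^ n) \<theta>))"
    by (rule continuous_on_compose2[OF cont_A continuous_on_iterate]) simp
  from continuous_on_matrix_mult[OF this Suc] show ?case by (simp cong: continuous_on_cong)
qed simp

lemma cocycle_add: "cocycle \<gamma> A (m + n) \<theta> = cocycle \<gamma> A m ((\<gamma> ^^ n) \<theta>) ** cocycle \<gamma> A n \<theta>"
  by (induction m) (simp_all add: matrix_mul_assoc[symmetric] funpow_add)

lemma matrix_norm_cocycle_le: "matrix_norm (cocycle \<gamma> A n \<theta>) \<le> bound ^ n"
proof (induction n)
  case 0
  then show ?case by (auto intro!: onorm_le)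
next
  case (Suc n)
  have "matrix_norm (cocycle \<gamma> A (Suc n) \<theta>)
      \<le> matrix_norm (A ((\<gamma> ^^ n) \<theta>)) * matrix_norm (cocycle \<gamma> A n \<theta>)"
    by (simp add: matrix_norm_mult_le)
  also have "\<dots> \<le> bound * bound ^ n"
    using bound_ge_1 by (intro mult_mono matrix_norm_le_bound Suc) (auto simp: matrix_norm_nonneg)
  finally show ?case by simp
qed

lemma matrix_norm_cocycle_ge_1: "1 \<le> matrix_norm (cocycle \<gamma> A n \<theta>)"
  by (rule matrix_norm_ge_1[OF det_cocycle])

text \<open>The finite-time Lyapunov exponent. Division by zero makes it 0 at \<open>n = 0\<close>,
  in agreement with both bounds below.\<close>

definition growth :: "'a \<Rightarrow> nat \<Rightarrow> real" where
  "growth \<theta> n = 1 / real n * ln (matrix_norm (cocycle \<gamma> A n \<theta>))"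

lemma growth_nonneg: "0 \<le> growth \<theta> n"
  unfolding growth_def using matrix_norm_cocycle_ge_1[of n \<theta>] by simp

lemma growth_le: "growth \<theta> n \<le> ln bound"
proof (cases "n = 0")
  case False
  have "ln (matrix_norm (cocycle \<gamma> A n \<theta>)) \<le> ln (bound ^ n)"
    using matrix_norm_cocycle_le[of n \<theta>] matrix_norm_cocycle_ge_1[of n \<theta>] by simp
  also have "\<dots> = n * ln bound" using bound_ge_1 by (simp add: ln_realpow)
  finally show ?thesis using False by (simp add: growth_def field_simps)
qed (use bound_ge_1 in \<open>simp add: growth_def\<close>)

abbreviation lyap :: real where "lyap \<equiv> lyapunov_max \<gamma> A"

text \<open>All finite-time exponents lie in \<open>[0, ln bound]\<close>, so the extended real
  supremum is finite and \<open>real_of_ereal\<close> loses nothing.\<close>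

lemma ereal_lyap: "ereal lyap = (SUP \<theta>. limsup (\<lambda>n. ereal (growth \<theta> n)))"
proof -
  let ?S = "SUP \<theta>. limsup (\<lambda>n. ereal (growth \<theta> n))"
  have "limsup (\<lambda>n. ereal (growth \<theta> n)) \<le> ereal (ln bound)" for \<theta>
    by (rule Limsup_bounded) (simp add: growth_le)
  then have "?S \<le> ereal (ln bound)" by (intro SUP_least)
  moreover have "0 \<le> ?S"
  proof (rule SUP_upper2)
    show "0 \<le> limsup (\<lambda>n. ereal (growth \<theta> n))" for \<theta>
      by (rule le_Limsup) (simp_all add: growth_nonneg)
  qed simp
  ultimately have "\<bar>?S\<bar> \<noteq> \<infinity>" by (cases ?S) auto
  then show ?thesis
    unfolding lyapunov_max_def growth_def[symmetric] by (simp add: ereal_real')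
qed

lemma lyap_nonneg: "0 \<le> lyap"
proof -
  have "0 \<le> limsup (\<lambda>n. ereal (growth \<theta> n))" for \<theta>
    by (rule le_Limsup) (simp_all add: growth_nonneg)
  then have "0 \<le> ereal lyap"
    unfolding ereal_lyap by (rule SUP_upper2[OF UNIV_I])
  then show ?thesis by simp
qed

text \<open>By compactness finitely many block lengths suffice, and every orbit segment is decomposed
  greedily into such blocks and a short remainder.\<close>
lemma uniform_growth:
  assumes "lyap < l"
  obtains C where "1 \<le> C" "\<And>n \<theta>. matrix_norm (cocycle \<gamma> A n \<theta>) \<le> C * exp l ^ n"
proof -
  define U where "U n = {\<theta>. matrix_norm (cocycle \<gamma> A n \<theta>) < exp l ^ n}" for n
  have opn: "open (U n)" for n
    unfolding U_def
    by (intro open_Collect_less continuous_intros continuous_matrix_norm continuous_on_cocycle)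
  \<comment> \<open>Only positive lengths enter the cover: a block of length 0 would stall the
    greedy decomposition.\<close>
  have cover: "UNIV \<subseteq> (\<Union>n\<in>{0<..}. U n)"
  proof
    fix \<theta>
    have "limsup (\<lambda>n. ereal (growth \<theta> n)) \<le> ereal lyap"
      unfolding ereal_lyap by (rule SUP_upper) simp
    also have "\<dots> < ereal l" using assms by simp
    finally have "\<forall>\<^sub>F n in sequentially. ereal (growth \<theta> n) < ereal l"
      by (rule Limsup_lessD)
    then have "\<forall>\<^sub>F n in sequentially. growth \<theta> n < l \<and> 0 < n"
      using eventually_gt_at_top[of "0::nat"] by eventually_elim auto
    then obtain n where n: "growth \<theta> n < l" "0 < n"
      using eventually_happens trivial_limit_sequentially by blast
    then have "ln (matrix_norm (cocycle \<gamma> A n \<theta>)) < n * l"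
      by (simp add: growth_def field_simps)
    then have "matrix_norm (cocycle \<gamma> A n \<theta>) < exp (n * l)"
      using matrix_norm_cocycle_ge_1[of n \<theta>] by (metis exp_less_mono exp_ln less_le_trans zero_less_one)
    then show "\<theta> \<in> (\<Union>n\<in>{0<..}. U n)"
      using n by (auto simp: U_def exp_of_nat_mult)
  qed
  obtain F where F: "F \<subseteq> {0<..}" "finite F" "UNIV \<subseteq> (\<Union>n\<in>F. U n)"
    using compactE_image[OF compact_UNIV opn cover] by blast
  \<comment> \<open>\<open>N\<close> bounds every block length, hence also the length of the final
    remainder; \<open>insert 0\<close> avoids asking whether \<open>F\<close> is empty.\<close>
  define N where "N = Max (insert 0 F)"
  have N: "n \<le> N" if "n \<in> F" for n using that F(2) by (simp add: N_def)
  have l1: "1 \<le> exp l" using assms lyap_nonneg by simp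
  have *: "matrix_norm (cocycle \<gamma> A n \<theta>) \<le> bound ^ N * exp l ^ n" for n \<theta>
  proof (induction n arbitrary: \<theta> rule: less_induct)
    case (less n)
    obtain k where k: "k \<in> F" "\<theta> \<in> U k" using F(3) by blast
    show ?case
    proof (cases "k \<le> n")
      case True
      have "matrix_norm (cocycle \<gamma> A n \<theta>) =
          matrix_norm (cocycle \<gamma> A (n - k) ((\<gamma> ^^ k) \<theta>) ** cocycle \<gamma> A k \<theta>)"
        using cocycle_add[of "n - k" k \<theta>] True by simp
      also have "\<dots> \<le> matrix_norm (cocycle \<gamma> A (n - k) ((\<gamma> ^^ k) \<theta>)) * matrix_norm (cocycle \<gamma> A k \<theta>)"
        by (rule matrix_norm_mult_le)
      also have "\<dots> \<le> (bound ^ N * exp l ^ (n - k)) * exp l ^ k"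
      proof (rule mult_mono)
        show "matrix_norm (cocycle \<gamma> A (n - k) ((\<gamma> ^^ k) \<theta>)) \<le> bound ^ N * exp l ^ (n - k)"
          using less True k(1) F(1) by auto
      qed (use k bound_ge_1 in \<open>auto simp: U_def matrix_norm_nonneg\<close>)
      also have "\<dots> = bound ^ N * exp l ^ n" using True by (simp add: power_add[symmetric])
      finally show ?thesis .
    next
      case False
      have "matrix_norm (cocycle \<gamma> A n \<theta>) \<le> bound ^ n * 1"
        using matrix_norm_cocycle_le by simp
      also have "\<dots> \<le> bound ^ N * exp l ^ n"
        using False N[OF k(1)] bound_ge_1 l1
        by (intro mult_mono power_increasing one_le_power) auto
      finally show ?thesis .
    qed
  qed
  show ?thesis by (rule that[OF _ *]) (use bound_ge_1 in simp)
qed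

section \<open>The inverse cocycle along backward orbits\<close>

text \<open>This is the inverse of the \<open>n\<close>-step cocycle ending over \<theta>: the
  vector over \<open>(\<gamma>' ^^ n) \<theta>\<close> that the linear cocycle carries to
  \<open>w\<close>.\<close>

primrec backward :: "nat \<Rightarrow> 'a \<Rightarrow> real^2 \<Rightarrow> real^2" where
  "backward 0 \<theta> w = w"
| "backward (Suc n) \<theta> w = backward n (\<gamma>' \<theta>) (adj2 (A (\<gamma>' \<theta>)) *v w)"

lemma adj2_A [simp]: "adj2 (A \<theta>) *v (A \<theta> *v w) = w" "A \<theta> *v (adj2 (A \<theta>) *v w) = w"
  by (simp_all add: adj2_mult det_A)

lemma iterate_inverse: "(\<gamma> ^^ n) ((\<gamma>' ^^ n) \<theta>) = \<theta>"
proof (induction n arbitrary: \<theta>)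
  case (Suc n)
  have "(\<gamma> ^^ Suc n) x = (\<gamma> ^^ n) (\<gamma> x)" for x
    by (simp only: funpow_Suc_right o_apply)
  then show ?case using Suc by simp
qed simp

lemma cocycle_backward: "cocycle \<gamma> A n ((\<gamma>' ^^ n) \<theta>) *v backward n \<theta> w = w"
proof (induction n arbitrary: \<theta> w)
  case (Suc n)
  have "cocycle \<gamma> A n ((\<gamma>' ^^ Suc n) \<theta>) *v backward (Suc n) \<theta> w = adj2 (A (\<gamma>' \<theta>)) *v w"
    using Suc[of "\<gamma>' \<theta>" "adj2 (A (\<gamma>' \<theta>)) *v w"] by (simp add: funpow_swap1)
  moreover have "(\<gamma> ^^ n) ((\<gamma>' ^^ Suc n) \<theta>) = \<gamma>' \<theta>"
    using iterate_inverse[of n "\<gamma>' \<theta>"] by (simp add: funpow_swap1)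
  ultimately show ?case by (simp add: matrix_vector_mul_assoc[symmetric] del: backward.simps)
qed simp

lemma backward_eq_adj2: "backward n \<theta> w = adj2 (cocycle \<gamma> A n ((\<gamma>' ^^ n) \<theta>)) *v w"
  using cocycle_backward[of n \<theta> w] adj2_mult(2)[OF det_cocycle] by metis

lemma norm_backward_le: "norm (backward n \<theta> w) \<le> matrix_norm (cocycle \<gamma> A n ((\<gamma>' ^^ n) \<theta>)) * norm w"
  unfolding backward_eq_adj2 by (rule norm_adj2_mult_le[OF det_cocycle])

lemma norm_le_backward: "norm w \<le> matrix_norm (cocycle \<gamma> A n ((\<gamma>' ^^ n) \<theta>)) * norm (backward n \<theta> w)"
  using norm_mult_le cocycle_backward by metis

text \<open>Inverse cocycles preserve area as well. Two vectors whose backward norms have product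
  tending to 0 must therefore be parallel.\<close>

lemma wedge_backward: "wedge (backward n \<theta> w) (backward n \<theta> z) = wedge w z"
  using wedge_mult[of "cocycle \<gamma> A n ((\<gamma>' ^^ n) \<theta>)" "backward n \<theta> w" "backward n \<theta> z"]
  by (simp add: cocycle_backward det_cocycle)

lemma backward_scaleR: "backward n \<theta> (c *\<^sub>R w) = c *\<^sub>R backward n \<theta> w"
  by (simp add: backward_eq_adj2 matrix_vector_mult_scaleR)

lemma backward_cocycle:
  "j \<le> m \<Longrightarrow> backward j ((\<gamma> ^^ m) \<theta>) (cocycle \<gamma> A m \<theta> *v v) = cocycle \<gamma> A (m - j) \<theta> *v v"
proof (induction j arbitrary: m)
  case (Suc j)
  then obtain m' where m: "m = Suc m'" "j \<le> m'" by (cases m) auto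
  show ?case using Suc.IH[OF m(2)] by (simp add: m(1) matrix_vector_mul_assoc[symmetric])
qed simp

lemma continuous_on_backward:
  assumes "continuous_on S f" "continuous_on S g"
  shows "continuous_on S (\<lambda>x. backward n (f x) (g x))"
  using assms
proof (induction n arbitrary: f g)
  case (Suc n)
  have 1: "continuous_on S (\<lambda>x. \<gamma>' (f x))"
    by (rule continuous_on_compose2[OF cont_\<gamma>' Suc.prems(1)]) simp
  have 2: "continuous_on S (\<lambda>x. adj2 (A (\<gamma>' (f x))) *v g x)"
    by (intro continuous_on_mult_vec continuous_on_adj2 Suc.prems
        continuous_on_compose2[OF cont_A 1]) simp
  show ?case using Suc.IH[OF 1 2] by simp
qed simp

section \<open>Directions contracted in backward time\<close>

text \<open>Some \<theta> has upper limit above \<open>k\<close>, and an upper limit above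
  \<open>k\<close> is exceeded at infinitely many times; the rate need not persist at all large
  times.\<close>

lemma frequent_growth:
  assumes "k < lyap"
  shows "\<exists>\<theta>. \<exists>\<^sub>F n in sequentially. exp k ^ n < matrix_norm (cocycle \<gamma> A n \<theta>)"
proof -
  have "ereal k < (SUP \<theta>. limsup (\<lambda>n. ereal (growth \<theta> n)))"
    using assms by (simp add: ereal_lyap[symmetric])
  then obtain \<theta> where "ereal k < limsup (\<lambda>n. ereal (growth \<theta> n))"
    by (auto simp: less_SUP_iff)
  then have "\<exists>\<^sub>F n in sequentially. ereal k < ereal (growth \<theta> n)"
    using Limsup_bounded[of "\<lambda>n. ereal (growth \<theta> n)" "ereal k" sequentially]
    by (auto simp: frequently_def not_less)
  then have "\<exists>\<^sub>F n in sequentially. k < growth \<theta> n \<and> 0 < n"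
    using frequently_eventually_frequently[OF _ eventually_gt_at_top[of "0::nat"]] by simp
  then have "\<exists>\<^sub>F n in sequentially. exp k ^ n < matrix_norm (cocycle \<gamma> A n \<theta>)"
  proof (rule frequently_elim1)
    fix n assume n: "k < growth \<theta> n \<and> 0 < n"
    then have "n * k < ln (matrix_norm (cocycle \<gamma> A n \<theta>))"
      by (auto simp: growth_def pos_less_divide_eq mult.commute)
    then have "exp (n * k) < matrix_norm (cocycle \<gamma> A n \<theta>)"
      using matrix_norm_cocycle_ge_1[of n \<theta>] by (metis exp_less_mono exp_ln less_le_trans zero_less_one)
    then show "exp k ^ n < matrix_norm (cocycle \<gamma> A n \<theta>)" by (simp add: exp_of_nat_mult)
  qed
  then show ?thesis by blast
qed

text \<open>Looking back from a time at which \<open>exp (- k m) * norm (A\<^sub>m v)\<close> is maximal, the orbit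
  has been growing at rate at least \<open>k\<close> over every backward window.\<close>
lemma backward_contraction_finite:
  assumes "0 < k" "k < lyap"
  shows "\<exists>\<theta> u. norm u = 1 \<and> (\<forall>j\<le>N. norm (backward j \<theta> u) \<le> exp (- k) ^ j)"
proof -
  \<comment> \<open>The gap between \<open>l\<close> and \<open>k\<close> produces a surplus
    \<open>exp (l - k) ^ n\<close>, which is made at least \<open>bound ^ N\<close> in order to
    force the maximizing time past \<open>N\<close>.\<close>
  obtain l where l: "k < l" "l < lyap" using assms dense by blast
  from frequent_growth[OF l(2)] obtain \<theta> where
    fr: "\<exists>\<^sub>F n in sequentially. exp l ^ n < matrix_norm (cocycle \<gamma> A n \<theta>)" by blast
  obtain n\<^sub>0 where "bound ^ N < exp (l - k) ^ n\<^sub>0"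
    using real_arch_pow[of "exp (l - k)"] l by auto
  moreover have "exp (l - k) ^ n\<^sub>0 \<le> exp (l - k) ^ n" if "n\<^sub>0 \<le> n" for n
    using that l by (intro power_increasing) auto
  ultimately have "\<forall>\<^sub>F n in sequentially. bound ^ N \<le> exp (l - k) ^ n"
    unfolding eventually_sequentially by (meson less_imp_le order_trans)
  from frequently_ex[OF frequently_eventually_frequently[OF fr this]]
  obtain n where n: "exp l ^ n < matrix_norm (cocycle \<gamma> A n \<theta>)" "bound ^ N \<le> exp (l - k) ^ n"
    by auto
  have "\<exists>v. exp l ^ n * norm v < norm (cocycle \<gamma> A n \<theta> *v v)"
  proof (rule ccontr)
    assume "\<not> ?thesis"
    then have "matrix_norm (cocycle \<gamma> A n \<theta>) \<le> exp l ^ n" by (intro onorm_le) (simp add: not_less)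
    then show False using n by simp
  qed
  then obtain v where v: "exp l ^ n * norm v < norm (cocycle \<gamma> A n \<theta> *v v)" by blast
  then have v0: "v \<noteq> 0" by auto
  define a where "a i = norm (cocycle \<gamma> A i \<theta> *v v)" for i
  define b where "b i = a i * exp (- k) ^ i" for i
  have a0: "a 0 = norm v" "b 0 = norm v" by (simp_all add: a_def b_def)
  have "\<exists>m\<in>{..n}. \<forall>i\<in>{..n}. b i \<le> b m"
    using Max_in[of "b ` {..n}"] Max_ge[of "b ` {..n}"] by fastforce
  then obtain m where m: "m \<le> n" "\<And>i. i \<le> n \<Longrightarrow> b i \<le> b m" by auto
  have apos: "0 < a i" for i
  proof -
    have "cocycle \<gamma> A i \<theta> *v v \<noteq> 0"
      using adj2_mult(2)[OF det_cocycle, of i \<theta> v] v0 by (metis matrix_vector_mult_0_right)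
    then show ?thesis by (simp add: a_def)
  qed
  \<comment> \<open>A maximum before time \<open>N\<close> is impossible: there the weighted norm is
    at most \<open>bound ^ N * norm v\<close>, while \<open>b n\<close> exceeds this value.\<close>
  have "N \<le> m"
  proof (rule ccontr)
    assume "\<not> N \<le> m"
    have "bound ^ N * norm v \<le> exp (l - k) ^ n * norm v" using n by (intro mult_right_mono) auto
    also have "\<dots> = exp l ^ n * norm v * exp (- k) ^ n"
      by (simp add: exp_diff exp_minus power_divide field_simps power_inverse)
    also have "\<dots> < b n" using v by (simp add: b_def a_def)
    also have "\<dots> \<le> b m" using m by simp
    also have "\<dots> \<le> a m * 1"
      unfolding b_def using assms apos[of m] by (intro mult_left_mono power_le_one) auto
    also have "\<dots> \<le> matrix_norm (cocycle \<gamma> A m \<theta>) * norm v"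
      by (simp add: a_def norm_mult_le)
    also have "\<dots> \<le> bound ^ m * norm v"
      by (intro mult_right_mono matrix_norm_cocycle_le) simp
    also have "\<dots> \<le> bound ^ N * norm v"
      using bound_ge_1 \<open>\<not> N \<le> m\<close> by (intro mult_right_mono power_increasing) auto
    finally show False by simp
  qed
  define u where "u = (1 / a m) *\<^sub>R (cocycle \<gamma> A m \<theta> *v v)"
  have "norm (backward j ((\<gamma> ^^ m) \<theta>) u) \<le> exp (- k) ^ j" if "j \<le> N" for j
  proof -
    have jm: "j \<le> m" using that \<open>N \<le> m\<close> by simp
    have "a (m - j) * exp (- k) ^ (m - j) \<le> a m * exp (- k) ^ m"
      using m(2)[of "m - j"] m(1) by (simp add: b_def)
    also have "\<dots> = a m * exp (- k) ^ j * exp (- k) ^ (m - j)"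
      using jm by (simp add: power_add[symmetric])
    finally have "a (m - j) \<le> a m * exp (- k) ^ j" by simp
    then show ?thesis
      using apos[of m] jm
      by (simp add: u_def backward_scaleR backward_cocycle a_def[symmetric] field_simps)
  qed
  moreover have "norm u = 1" using apos[of m] by (simp add: u_def a_def)
  ultimately show ?thesis by blast
qed

text \<open>The pairs that work up to time \<open>N\<close> form nested nonempty closed subsets of a
  compact space. By the finite intersection property one pair works for all times.\<close>

lemma backward_contraction:
  assumes "0 < k" "k < lyap"
  obtains \<theta> u where "norm u = 1" "\<And>j. norm (backward j \<theta> u) \<le> exp (- k) ^ j"
proof -
  define K where "K N = {p. snd p \<in> sphere 0 1 \<and> (\<forall>j\<le>N. norm (backward j (fst p) (snd p)) \<le> exp (- k) ^ j)}"
    for N :: nat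
  have cs: "compact (UNIV \<times> sphere 0 1 :: ('a \<times> (real^2)) set)"
    by (intro compact_Times compact_UNIV compact_sphere)
  have "(UNIV \<times> sphere 0 1) \<inter> \<Inter> (range K) \<noteq> {}"
  proof (rule compact_imp_fip[OF cs])
    fix T assume "T \<in> range K"
    then obtain N where T: "T = K N" by blast
    have "closed (\<Inter>j\<in>{..N}. {p::'a \<times> (real^2). norm (backward j (fst p) (snd p)) \<le> exp (- k) ^ j})"
      by (intro closed_INT ballI closed_Collect_le continuous_intros continuous_on_backward)
    moreover have "closed ((UNIV :: 'a set) \<times> sphere (0::real^2) 1)" by (intro closed_Times) auto
    ultimately have "closed ((UNIV \<times> sphere 0 1) \<inter> (\<Inter>j\<in>{..N}. {p::'a \<times> (real^2). norm (backward j (fst p) (snd p)) \<le> exp (- k) ^ j}))"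
      by (rule closed_Int[rotated])
    also have "\<dots> = T" unfolding T K_def by auto
    finally show "closed T" .
  next
    fix F assume F: "finite F" "F \<subseteq> range K"
    then obtain J where J: "finite J" "F = K ` J" using finite_subset_image by meson
    define N where "N = Max (insert 0 J)"
    obtain \<theta> u where *: "norm u = 1" "\<forall>j\<le>N. norm (backward j \<theta> u) \<le> exp (- k) ^ j"
      using backward_contraction_finite[OF assms] by blast
    have "n \<le> N" if "n \<in> J" for n using that J(1) by (simp add: N_def)
    then have "(\<theta>, u) \<in> (UNIV \<times> sphere 0 1) \<inter> \<Inter>F"
      using * unfolding J K_def by fastforce
    then show "(UNIV \<times> sphere 0 1) \<inter> \<Inter>F \<noteq> {}" by blast
  qed
  then obtain p where p: "\<And>N. p \<in> K N" by auto
  have "norm (snd p) = 1" using p[of 0] by (simp add: K_def)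
  moreover have "norm (backward j (fst p) (snd p)) \<le> exp (- k) ^ j" for j
    using p[of j] by (simp add: K_def)
  ultimately show ?thesis by (rule that)
qed

end

section \<open>Invariant radial functions\<close>

text \<open>The fibre maps fix 0 and \<gamma> is onto. It is placed before
  \<open>saturated_cocycle\<close> because the parameter \<beta> = 0, excluded there, uses it as
  well.\<close>

lemma (in sl2_cocycle) iterate_zero_section:
  "(skew_product \<gamma> A h \<beta> ^^ n) ` (UNIV \<times> {0}) = UNIV \<times> {0}"
proof (induction n)
  case (Suc n)
  have "surj \<gamma>" using inv_simps(2) by (metis surjI)
  then have zero: "skew_product \<gamma> A h \<beta> ` (UNIV \<times> {0}) = UNIV \<times> {0}"
    by (auto simp: skew_product_def fibre_map_def image_iff surj_def)
  have "(skew_product \<gamma> A h \<beta> ^^ Suc n) ` (UNIV \<times> {0}) =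
      skew_product \<gamma> A h \<beta> ` ((skew_product \<gamma> A h \<beta> ^^ n) ` (UNIV \<times> {0}))"
    by (simp only: funpow.simps image_comp)
  then show ?case by (simp only: Suc zero)
qed simp

text \<open>\<open>h_bound\<close> is the bound on the supremum of \<open>h\<close> with the
  denominator cleared. The value \<beta> = 0 is left out because the fibre maps then vanish; the
  theorem settles it directly.\<close>

locale saturated_cocycle = sl2_cocycle +
  fixes h :: "real \<Rightarrow> real" and \<beta> :: real
  assumes h_0 [simp]: "h 0 = 0"
    and strict_mono_h: "strict_mono_on {0..} h"
    and cont_h: "continuous_on {0..} h"
    and concave_h: "strictly_concave_on {0..} h"
    and deriv_h: "(h has_real_derivative 1) (at 0 within {0..})"
    and h_bound: "0 \<le> x \<Longrightarrow> h x * bound \<le> 1"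
    and \<beta>_pos: "0 < \<beta>"
begin

section \<open>Monotonicity and concavity estimates for \<open>h\<close>\<close>

lemma h_less_iff: "0 \<le> x \<Longrightarrow> 0 \<le> y \<Longrightarrow> h x < h y \<longleftrightarrow> x < y"
  using strict_mono_on_less[OF strict_mono_h] by simp

lemma h_le_iff: "0 \<le> x \<Longrightarrow> 0 \<le> y \<Longrightarrow> h x \<le> h y \<longleftrightarrow> x \<le> y"
  using strict_mono_on_less_eq[OF strict_mono_h] by simp

lemma h_pos_iff: "0 \<le> x \<Longrightarrow> 0 < h x \<longleftrightarrow> 0 < x"
  using h_less_iff[of 0 x] by simp

lemma h_nonneg: "0 \<le> x \<Longrightarrow> 0 \<le> h x"
  using h_le_iff[of 0 x] by simp

lemma h_concave:
  "0 \<le> x \<Longrightarrow> 0 \<le> y \<Longrightarrow> x \<noteq> y \<Longrightarrow> 0 < t \<Longrightarrow> t < 1 \<Longrightarrow>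
    (1 - t) * h x + t * h y < h ((1 - t) * x + t * y)"
  using concave_h unfolding strictly_concave_on_def by simp

text \<open>Strict concavity at the midpoint of 0 and \<open>x\<close>. This strict inequality is
  the source of the contraction factor below 1.\<close>

lemma h_half: "0 < x \<Longrightarrow> h x < 2 * h (x / 2)"
  using h_concave[of 0 x "1/2"] by simp

lemma h_quotient_tendsto: "((\<lambda>x. h x / x) \<longlongrightarrow> 1) (at_right 0)"
proof -
  have "((\<lambda>x. (h x - h 0) / (x - 0)) \<longlongrightarrow> 1) (at 0 within {0..})"
    using deriv_h by (simp add: has_field_derivative_iff)
  then have "((\<lambda>x. (h x - h 0) / (x - 0)) \<longlongrightarrow> 1) (at_right 0)"
    by (rule tendsto_within_subset) auto
  then show ?thesis by simp
qed

text \<open>Concavity makes \<open>h x / x\<close> decrease in \<open>x\<close>, and its limit at 0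
  is the derivative 1.\<close>

lemma h_le: "0 \<le> x \<Longrightarrow> h x \<le> x"
proof (cases "x = 0")
  case False
  assume "0 \<le> x"
  with False have x: "0 < x" by simp
  have "h x / x \<le> 1"
  proof (rule tendsto_lowerbound[OF h_quotient_tendsto])
    have "\<forall>\<^sub>F y in at_right 0. y < x" using x by (auto simp: eventually_at_right_field)
    moreover have "\<forall>\<^sub>F y in at_right (0::real). 0 < y" by (auto simp: eventually_at_right_field intro: exI[of _ 1])
    ultimately show "\<forall>\<^sub>F y in at_right 0. h x / x \<le> h y / y"
    proof eventually_elim
      case (elim y)
      have "(y / x) * h x < h ((y / x) * x)"
        using h_concave[of 0 x "y / x"] elim by (simp add: field_simps)
      then show ?case using elim by (simp add: field_simps)
    qed
  qed simp
  then show ?thesis using x by (simp add: field_simps)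
qed simp

text \<open>The function \<open>h (\<beta> * r)\<close> of \<open>r\<close> has slope \<beta> at 0,
  so near 0 it stays above a line of smaller slope.\<close>

lemma h_lower_linear:
  assumes "b < \<beta>"
  obtains d where "0 < d" "\<And>r. 0 \<le> r \<Longrightarrow> r \<le> d \<Longrightarrow> b * r \<le> h (\<beta> * r)"
proof -
  have "b / \<beta> < 1" using assms \<beta>_pos by simp
  from order_tendstoD(1)[OF h_quotient_tendsto this]
  obtain e where e: "0 < e" "\<And>y. 0 < y \<Longrightarrow> y < e \<Longrightarrow> b / \<beta> < h y / y"
    by (auto simp: eventually_at_right_field)
  \<comment> \<open>Taking half of \<open>e / \<beta>\<close> keeps \<open>\<beta> * r\<close>
    strictly below \<open>e\<close> at the closed endpoint.\<close>
  have "b * r \<le> h (\<beta> * r)" if "0 \<le> r" "r \<le> e / (2 * \<beta>)" for r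
  proof (cases "r = 0")
    case False
    then have "0 < \<beta> * r" "\<beta> * r < e"
      using that \<beta>_pos e(1) by (auto simp: field_simps)
    from e(2)[OF this] False that \<beta>_pos show ?thesis by (simp add: field_simps)
  qed simp
  moreover have "0 < e / (2 * \<beta>)" using e \<beta>_pos by simp
  ultimately show ?thesis using that by blast
qed

text \<open>The chord slope over \<open>[x / 2, x]\<close> is
  \<open>(2 / x) * (h x - h (x / 2))\<close>; by concavity it dominates the chord slope over
  \<open>[x, y]\<close>.\<close>

lemma h_slope:
  assumes "0 < x" "x \<le> y"
  shows "h y - h x \<le> (y - x) * (2 / x) * (h x - h (x / 2))"
proof (cases "x = y")
  case False
  define D where "D = y - x / 2"
  \<comment> \<open>With this weight on \<open>y\<close>, the point \<open>x\<close> is a convex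
    combination of \<open>x / 2\<close> and \<open>y\<close>.\<close>
  define t where "t = (x / 2) / D"
  have D: "0 < D" "x / 2 < D" using assms False by (auto simp: D_def)
  then have t: "0 < t" "t < 1" using assms by (auto simp: t_def)
  have "t * D = x / 2" using D by (simp add: t_def)
  moreover have "(1 - t) * (x / 2) + t * y = x / 2 + t * D" by (simp add: D_def field_simps)
  ultimately have t3: "(1 - t) * (x / 2) + t * y = x" by simp
  have "t * ((y - x) * (2 / x)) = (y - x) / D" using assms D by (simp add: t_def field_simps)
  also have "\<dots> = 1 - t" using D by (simp add: t_def D_def diff_divide_distrib[symmetric] field_simps)
  finally have t4: "t * ((y - x) * (2 / x)) = 1 - t" .
  have "(1 - t) * h (x / 2) + t * h y < h x"
    using h_concave[of "x/2" y t] assms t t3 False by simp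
  then have "t * (h y - h x) \<le> (1 - t) * (h x - h (x / 2))"
    by (simp add: algebra_simps)
  also have "\<dots> = t * ((y - x) * (2 / x) * (h x - h (x / 2)))"
    using t4 by (metis mult.assoc)
  finally show ?thesis using t(1) by (simp only: mult_le_cancel_left_pos)
qed simp

text \<open>Dividing the chord estimate by \<open>h x\<close> yields the factor \<open>g x\<close>,
  continuous and below 1 by \<open>h_half\<close>; \<open>q\<close> is its maximum on
  \<open>[a, b]\<close>. Only the smaller point \<open>x\<close> is confined to that
  interval.\<close>

lemma h_ratio_contraction:
  assumes "0 < a" "a \<le> b"
  obtains q where "0 \<le> q" "q < 1"
    "\<And>x y. a \<le> x \<Longrightarrow> x \<le> y \<Longrightarrow> x \<le> b \<Longrightarrow> h y / h x - 1 \<le> q * (y / x - 1)"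
proof -
  define g where "g x = 2 * (1 - h (x / 2) / h x)" for x
  have "continuous_on {a..b} g"
    unfolding g_def
  proof (intro continuous_intros)
    show "continuous_on {a..b} h"
      by (rule continuous_on_subset[OF cont_h]) (use assms in auto)
    show "continuous_on {a..b} (\<lambda>x. h (x / 2))"
      by (rule continuous_on_compose2[OF cont_h]) (use assms in \<open>auto intro!: continuous_intros\<close>)
    show "\<forall>x\<in>{a..b}. h x \<noteq> 0"
    proof
      fix x assume "x \<in> {a..b}"
      then have "0 < x" using assms by simp
      then show "h x \<noteq> 0" using h_pos_iff[of x] by simp
    qed
  qed
  then obtain z where z: "z \<in> {a..b}" "\<And>x. x \<in> {a..b} \<Longrightarrow> g x \<le> g z"
    using continuous_attains_sup[of "{a..b}" g] assms by auto
  have z0: "0 < z" using z assms by simp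
  have hz: "0 < h z" using h_pos_iff z0 by simp
  have "h (z / 2) / h z \<le> 1" using hz h_less_iff[of "z/2" z] z0 by simp
  then have "0 \<le> g z" by (simp add: g_def)
  moreover have "g z < 1" using hz h_half[OF z0] by (simp add: g_def field_simps)
  moreover have "h y / h x - 1 \<le> g z * (y / x - 1)" if "a \<le> x" "x \<le> y" "x \<le> b" for x y
  proof -
    have x: "0 < x" "0 < h x" using that assms h_pos_iff[of x] by auto
    have "h y / h x - 1 = (h y - h x) / h x" using x by (simp add: field_simps)
    also have "\<dots> \<le> (y - x) * (2 / x) * (h x - h (x / 2)) / h x"
      using h_slope[OF x(1) that(2)] x by (intro divide_right_mono) auto
    also have "\<dots> = g x * (y / x - 1)" using x by (simp add: g_def field_simps)
    also have "\<dots> \<le> g z * (y / x - 1)"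
      using z(2)[of x] that x by (intro mult_right_mono) auto
    finally show ?thesis .
  qed
  ultimately show ?thesis using that by blast
qed

section \<open>The graph transform on radial functions\<close>

abbreviation pull :: "'a \<Rightarrow> real^2 \<Rightarrow> real^2" where
  "pull \<theta> w \<equiv> adj2 (A (\<gamma>' \<theta>)) *v w"

lemma pull_eq_0_iff [simp]: "pull \<theta> w = 0 \<longleftrightarrow> w = 0"
  using adj2_A(2)[of "\<gamma>' \<theta>" w] by (metis matrix_vector_mult_0_right)

lemma pull_nonzero: "w \<noteq> 0 \<Longrightarrow> pull \<theta> w \<noteq> 0"
  by simp

lemma norm_le_bound_pull: "norm w \<le> bound * norm (pull \<theta> w)"
proof -
  have "norm w \<le> matrix_norm (A (\<gamma>' \<theta>)) * norm (pull \<theta> w)"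
    using norm_mult_le[of "A (\<gamma>' \<theta>)" "pull \<theta> w"] by simp
  also have "\<dots> \<le> bound * norm (pull \<theta> w)"
    by (intro mult_right_mono matrix_norm_le_bound) simp
  finally show ?thesis .
qed

text \<open>The fibre maps send rays to rays, so they act on radial functions \<open>a\<close> (which to a point
  \<open>\<theta>\<close> and a direction \<open>w\<close> assign a radius): the graph of \<open>a\<close> is mapped onto the graph of \<open>push a\<close>.\<close>
definition push :: "('a \<Rightarrow> real^2 \<Rightarrow> real) \<Rightarrow> 'a \<Rightarrow> real^2 \<Rightarrow> real" where
  "push a \<theta> w = h (\<beta> * a (\<gamma>' \<theta>) (pull \<theta> w)) * (norm w / norm (pull \<theta> w))"

text \<open>Negative \<open>t\<close> is allowed, so these are functions of lines through 0; this
  encodes the symmetry of the fibre maps under \<open>w\<close> to \<open>- w\<close>.\<close>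

definition radial :: "('a \<Rightarrow> real^2 \<Rightarrow> real) \<Rightarrow> bool" where
  "radial a \<longleftrightarrow> (\<forall>\<theta> w. w \<noteq> 0 \<longrightarrow> 0 \<le> a \<theta> w) \<and> (\<forall>\<theta> w t. t \<noteq> 0 \<longrightarrow> a \<theta> (t *\<^sub>R w) = a \<theta> w)"

lemma radial_nonneg: "radial a \<Longrightarrow> w \<noteq> 0 \<Longrightarrow> 0 \<le> a \<theta> w"
  by (simp add: radial_def)

lemma radial_scaleR: "radial a \<Longrightarrow> t \<noteq> 0 \<Longrightarrow> a \<theta> (t *\<^sub>R w) = a \<theta> w"
  by (simp add: radial_def)

lemma radial_const: "0 \<le> c \<Longrightarrow> radial (\<lambda>_ _. c)"
  by (simp add: radial_def)

lemma radial_push: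
  assumes "radial a"
  shows "radial (push a)"
  unfolding radial_def push_def
  using assms \<beta>_pos
  by (auto simp: radial_nonneg radial_scaleR matrix_vector_mult_scaleR h_nonneg)

lemma push_mono:
  assumes "radial a" "radial b" "\<And>\<theta> w. w \<noteq> 0 \<Longrightarrow> a \<theta> w \<le> b \<theta> w" "w \<noteq> 0"
  shows "push a \<theta> w \<le> push b \<theta> w"
  unfolding push_def using assms \<beta>_pos
  by (intro mult_right_mono) (auto simp: h_le_iff radial_nonneg)

text \<open>The origin is cut out because it has no direction; the zero section is treated
  separately.\<close>

definition shell :: "('a \<Rightarrow> real^2 \<Rightarrow> real) \<Rightarrow> ('a \<Rightarrow> real^2 \<Rightarrow> real) \<Rightarrow> ('a \<times> (real^2)) set" where
  "shell a b = {(\<theta>, w). w \<noteq> 0 \<and> a \<theta> w \<le> norm w \<and> norm w \<le> b \<theta> w}"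

abbreviation F :: "'a \<times> (real^2) \<Rightarrow> 'a \<times> (real^2)" where
  "F \<equiv> skew_product \<gamma> A h \<beta>"

text \<open>On each ray the fibre map acts through the increasing function \<open>h\<close>, so it
  keeps the order of radii, which gives one inclusion. For the other, the intermediate value theorem
  finds the radius \<open>t\<close> of a preimage between the two given radii.\<close>

lemma skew_product_shell:
  assumes a: "radial a" and b: "radial b"
    and ab: "\<And>\<theta> w. w \<noteq> 0 \<Longrightarrow> a \<theta> w \<le> b \<theta> w"
  shows "F ` shell a b = shell (push a) (push b)"
proof (intro equalityI subsetI)
  fix p assume "p \<in> F ` shell a b"
  then obtain \<theta> v where v: "v \<noteq> 0" "a \<theta> v \<le> norm v" "norm v \<le> b \<theta> v"
    and p: "p = F (\<theta>, v)" by (auto simp: shell_def)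
  define s where "s = h (\<beta> * norm v) / norm v"
  have hv: "0 < h (\<beta> * norm v)" using v \<beta>_pos by (simp add: h_pos_iff)
  then have s: "0 < s" using v by (simp add: s_def)
  define w where "w = s *\<^sub>R (A \<theta> *v v)"
  have pw: "p = (\<gamma> \<theta>, w)"
    using v by (simp add: p w_def skew_product_def fibre_map_def s_def
        matrix_vector_mult_scaleR divide_inverse)
  have pull: "pull (\<gamma> \<theta>) w = s *\<^sub>R v" by (simp add: w_def matrix_vector_mult_scaleR)
  then have pull': "adj2 (A \<theta>) *v w = s *\<^sub>R v" by simp
  have w0: "w \<noteq> 0" using pull_eq_0_iff[of "\<gamma> \<theta>" w] s v unfolding pull by simp
  have nsv: "norm (s *\<^sub>R v) = h (\<beta> * norm v)" using hv v by (simp add: s_def)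
  \<comment> \<open>At the image point every pushed radius is \<open>norm w\<close> times a quotient
    of values of \<open>h\<close>, so comparisons with \<open>norm w\<close> reduce to comparisons
    of radii before mapping.\<close>
  have e: "push c (\<gamma> \<theta>) w = h (\<beta> * c \<theta> v) / h (\<beta> * norm v) * norm w" if "radial c" for c
    using radial_scaleR[OF that, of s \<theta> v] s by (simp add: push_def pull' nsv del: norm_scaleR)
  have "h (\<beta> * a \<theta> v) / h (\<beta> * norm v) \<le> 1"
    using v \<beta>_pos hv radial_nonneg[OF a v(1)] by (simp add: h_le_iff)
  then have 1: "push a (\<gamma> \<theta>) w \<le> norm w"
    unfolding e[OF a] using mult_right_mono[of _ 1 "norm w"] by (simp only: mult_1 norm_ge_zero)
  have "1 \<le> h (\<beta> * b \<theta> v) / h (\<beta> * norm v)"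
    using v \<beta>_pos hv radial_nonneg[OF b v(1)] by (simp add: h_le_iff)
  then have 2: "norm w \<le> push b (\<gamma> \<theta>) w"
    unfolding e[OF b] using mult_right_mono[of 1 _ "norm w"] by (simp only: mult_1 norm_ge_zero)
  show "p \<in> shell (push a) (push b)" unfolding pw shell_def using w0 1 2 by simp
next
  fix p assume "p \<in> shell (push a) (push b)"
  then obtain \<theta> w where p: "p = (\<theta>, w)" and w: "w \<noteq> 0" "push a \<theta> w \<le> norm w" "norm w \<le> push b \<theta> w"
    by (auto simp: shell_def)
  define v\<^sub>0 where "v\<^sub>0 = pull \<theta> w"
  define y where "y = norm v\<^sub>0"
  have v0: "v\<^sub>0 \<noteq> 0" using w by (simp add: v\<^sub>0_def)
  then have y: "0 < y" by (simp add: y_def)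
  let ?a = "a (\<gamma>' \<theta>) v\<^sub>0" and ?b = "b (\<gamma>' \<theta>) v\<^sub>0"
  have nn: "0 \<le> ?a" "?a \<le> ?b" using radial_nonneg[OF a v0] ab[OF v0] by auto
  have "h (\<beta> * ?a) * norm w \<le> y * norm w" "y * norm w \<le> h (\<beta> * ?b) * norm w"
    using w y unfolding push_def v\<^sub>0_def[symmetric] y_def[symmetric] by (simp_all add: field_simps)
  then have "h (\<beta> * ?a) \<le> y" "y \<le> h (\<beta> * ?b)" using w by auto
  moreover have "continuous_on {?a..?b} (\<lambda>t. h (\<beta> * t))"
    by (rule continuous_on_compose2[OF cont_h]) (use nn \<beta>_pos in \<open>auto intro!: continuous_intros\<close>)
  ultimately obtain t where t: "?a \<le> t" "t \<le> ?b" "h (\<beta> * t) = y"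
    using IVT'[of "\<lambda>t. h (\<beta> * t)" ?a y ?b] nn by auto
  have t0: "0 < t" using t y nn \<beta>_pos by (cases "t = 0") auto
  define v where "v = (t / y) *\<^sub>R v\<^sub>0"
  have nv: "norm v = t" using t0 y by (simp add: v_def y_def[symmetric])
  have "v \<noteq> 0" using nv t0 by auto
  moreover have "a (\<gamma>' \<theta>) v = ?a" "b (\<gamma>' \<theta>) v = ?b"
    unfolding v_def using t0 y by (auto intro!: radial_scaleR a b)
  ultimately have "(\<gamma>' \<theta>, v) \<in> shell a b" using t nv by (simp add: shell_def)
  moreover have "F (\<gamma>' \<theta>, v) = p"
  proof -
    have "fibre_map A h \<beta> (\<gamma>' \<theta>) v = y *\<^sub>R (A (\<gamma>' \<theta>) *v ((1 / y) *\<^sub>R v\<^sub>0))"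
      using \<open>v \<noteq> 0\<close> nv t t0 by (simp add: fibre_map_def v_def)
    also have "\<dots> = w" using y by (simp add: matrix_vector_mult_scaleR v\<^sub>0_def)
    finally show ?thesis by (simp add: skew_product_def p)
  qed
  ultimately show "p \<in> F ` shell a b" by force
qed

section \<open>Iterated radii and their limit\<close>

definition rho :: "real \<Rightarrow> nat \<Rightarrow> 'a \<Rightarrow> real^2 \<Rightarrow> real" where
  "rho c n = (push ^^ n) (\<lambda>_ _. c)"

lemma rho_0 [simp]: "rho c 0 \<theta> w = c"
  by (simp add: rho_def)

lemma rho_Suc: "rho c (Suc n) = push (rho c n)"
  by (simp add: rho_def)

lemma radial_rho: "0 \<le> c \<Longrightarrow> radial (rho c n)"
  by (induction n) (simp_all add: rho_Suc radial_push, simp add: rho_def radial_const)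

lemma rho_mono: "0 \<le> c \<Longrightarrow> c \<le> d \<Longrightarrow> w \<noteq> 0 \<Longrightarrow> rho c n \<theta> w \<le> rho d n \<theta> w"
proof (induction n arbitrary: \<theta> w)
  case (Suc n)
  then show ?case unfolding rho_Suc by (intro push_mono radial_rho) auto
qed simp

lemma rho_zero: "rho 0 n \<theta> w = 0"
  by (induction n arbitrary: \<theta> w) (simp_all add: rho_Suc push_def)

text \<open>Monotonicity of \<open>push\<close> is iterated; the comparison is meant for the
  invariant function \<open>envelope\<close> in the role of \<open>a\<close>.\<close>

lemma rho_le_rho_shift:
  assumes "radial a" "0 \<le> c" "\<And>\<theta> w. w \<noteq> 0 \<Longrightarrow> a \<theta> w \<ge> c" "w \<noteq> 0"
  shows "rho c n \<theta> w \<le> (push ^^ n) a \<theta> w"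
  using assms(4)
proof (induction n arbitrary: \<theta> w)
  case (Suc n)
  have "radial ((push ^^ n) a)" by (induction n) (simp_all add: assms radial_push)
  then show ?case unfolding rho_Suc funpow.simps o_apply
    using Suc assms by (intro push_mono radial_rho) auto
qed (use assms in simp)

text \<open>The linear part stretches by at most \<open>bound\<close>, which \<open>h_bound\<close>
  compensates: the fibre maps end in the unit ball.\<close>

lemma push_le_1:
  assumes "radial a"
  shows "push a \<theta> w \<le> 1"
proof (cases "w = 0")
  case False
  let ?x = "\<beta> * a (\<gamma>' \<theta>) (pull \<theta> w)"
  have x: "0 \<le> ?x" using radial_nonneg[OF assms] False \<beta>_pos by simp
  have "norm w / norm (pull \<theta> w) \<le> bound"
    using norm_le_bound_pull[of w \<theta>] False by (simp add: field_simps)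
  then have "push a \<theta> w \<le> h ?x * bound"
    unfolding push_def using h_nonneg[OF x] by (intro mult_left_mono)
  also have "\<dots> \<le> 1" by (rule h_bound[OF x])
  finally show ?thesis .
qed (simp add: push_def)

text \<open>The first push of the constant 1 is at most 1, and monotonicity of \<open>push\<close>
  propagates this to all later steps.\<close>

lemma rho_Suc_le: "w \<noteq> 0 \<Longrightarrow> rho 1 (Suc n) \<theta> w \<le> rho 1 n \<theta> w"
proof (induction n arbitrary: \<theta> w)
  case 0
  then show ?case using push_le_1[OF radial_rho, of 1 0] by (simp add: rho_Suc)
next
  case (Suc n)
  show ?case
    unfolding rho_Suc[of 1 "Suc n"] rho_Suc[of 1 n]
    using Suc by (intro push_mono radial_rho) (auto simp: radial_rho simp flip: rho_Suc)
qed

lemma rho_antimono: "w \<noteq> 0 \<Longrightarrow> m \<le> n \<Longrightarrow> rho 1 n \<theta> w \<le> rho 1 m \<theta> w"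
  by (rule lift_Suc_antimono_le[of "\<lambda>n. rho 1 n \<theta> w"]) (auto intro: rho_Suc_le)

lemma iterate_shell:
  assumes "0 \<le> c" "c \<le> d"
  shows "(F ^^ n) ` shell (\<lambda>_ _. c) (\<lambda>_ _. d) = shell (rho c n) (rho d n)"
proof (induction n)
  case (Suc n)
  have "(F ^^ Suc n) ` shell (\<lambda>_ _. c) (\<lambda>_ _. d) = F ` shell (rho c n) (rho d n)"
    by (simp flip: Suc add: image_comp)
  also have "\<dots> = shell (rho c (Suc n)) (rho d (Suc n))"
    unfolding rho_Suc using assms by (intro skew_product_shell radial_rho rho_mono) auto
  finally show ?case .
qed (simp add: rho_def)

text \<open>The radius of the attractor in the direction of \<open>w\<close>. Vectors are used in
  place of angles so that the matrices act on the argument directly.\<close>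

definition envelope :: "'a \<Rightarrow> real^2 \<Rightarrow> real" where
  "envelope \<theta> w = (INF n. rho 1 n \<theta> w)"

lemma bdd_below_rho: "w \<noteq> 0 \<Longrightarrow> bdd_below (range (\<lambda>n. rho 1 n \<theta> w))"
  using radial_nonneg[OF radial_rho] by (intro bdd_belowI[of _ 0]) auto

lemma le_envelope_iff: "w \<noteq> 0 \<Longrightarrow> x \<le> envelope \<theta> w \<longleftrightarrow> (\<forall>n. x \<le> rho 1 n \<theta> w)"
  unfolding envelope_def by (subst le_cINF_iff) (auto simp: bdd_below_rho)

lemma rho_tendsto_envelope:
  assumes "w \<noteq> 0"
  shows "(\<lambda>n. rho 1 n \<theta> w) \<longlonglongrightarrow> envelope \<theta> w"
  unfolding envelope_def
  using rho_antimono[OF assms]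
  by (intro LIMSEQ_decseq_INF[OF bdd_below_rho[OF assms]]) (auto simp: decseq_def)

lemma envelope_le_rho: "w \<noteq> 0 \<Longrightarrow> envelope \<theta> w \<le> rho 1 n \<theta> w"
  using le_envelope_iff by blast

lemma envelope_le_1: "w \<noteq> 0 \<Longrightarrow> envelope \<theta> w \<le> 1"
  using envelope_le_rho[of w \<theta> 0] by simp

lemma radial_envelope: "radial envelope"
  unfolding radial_def
  using radial_nonneg[OF radial_rho] radial_scaleR[OF radial_rho]
  by (auto simp: le_envelope_iff) (simp add: envelope_def radial_scaleR[OF radial_rho])

text \<open>Both sides are limits of \<open>rho 1 (Suc n)\<close>: one by continuity of
  \<open>h\<close>, the other by a shift of index.\<close>

lemma push_envelope:
  assumes "w \<noteq> 0"
  shows "push envelope \<theta> w = envelope \<theta> w"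
proof (rule LIMSEQ_unique)
  have nz: "pull \<theta> w \<noteq> 0" using assms by simp
  have "(\<lambda>n. h (\<beta> * rho 1 n (\<gamma>' \<theta>) (pull \<theta> w))) \<longlonglongrightarrow> h (\<beta> * envelope (\<gamma>' \<theta>) (pull \<theta> w))"
    by (rule continuous_on_tendsto_compose[OF cont_h])
      (use \<beta>_pos radial_nonneg[OF radial_rho nz] radial_nonneg[OF radial_envelope nz]
        in \<open>auto intro!: tendsto_intros rho_tendsto_envelope nz\<close>)
  then show "(\<lambda>n. rho 1 (Suc n) \<theta> w) \<longlonglongrightarrow> push envelope \<theta> w"
    unfolding rho_Suc push_def by (intro tendsto_mult_right)
  show "(\<lambda>n. rho 1 (Suc n) \<theta> w) \<longlonglongrightarrow> envelope \<theta> w"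
    by (rule LIMSEQ_Suc[OF rho_tendsto_envelope[OF assms]])
qed

lemma iterate_cball: "(F ^^ n) ` (UNIV \<times> cball 0 1) = UNIV \<times> {0} \<union> shell (\<lambda>_ _. 0) (rho 1 n)"
proof -
  have "UNIV \<times> cball 0 1 = UNIV \<times> {0} \<union> shell (\<lambda>_ _. 0) (\<lambda>_ _. 1)"
    by (auto simp: shell_def)
  moreover have "rho 0 n = (\<lambda>_ _. 0)" by (simp add: fun_eq_iff rho_zero)
  ultimately show ?thesis using iterate_shell[of 0 1 n] by (simp add: image_Un iterate_zero_section)
qed

text \<open>The \<open>n\<close>-th image of the unit ball is the region below
  \<open>rho 1 n\<close>; the intersection is the region below the infimum.\<close>

lemma mem_attractor_iff: "(\<theta>, w) \<in> attractor \<gamma> A h \<beta> \<longleftrightarrow> w = 0 \<or> norm w \<le> envelope \<theta> w"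
  unfolding attractor_def iterate_cball
  by (cases "w = 0") (auto simp: shell_def le_envelope_iff)

section \<open>Comparison of the iterated radii with the linear cocycle\<close>

text \<open>Since \<open>h x \<le> x\<close>, each push multiplies the radius by at most \<beta>
  times a quotient of norms, and these quotients telescope along the backward orbit.\<close>

lemma rho_upper:
  assumes "0 \<le> c" "w \<noteq> 0"
  shows "rho c n \<theta> w * norm (backward n \<theta> w) \<le> c * \<beta> ^ n * norm w"
  using assms(2)
proof (induction n arbitrary: \<theta> w)
  case (Suc n)
  let ?r = "rho c n (\<gamma>' \<theta>) (pull \<theta> w)"
  have nz: "pull \<theta> w \<noteq> 0" using Suc.prems by simp
  have r: "0 \<le> ?r" by (rule radial_nonneg[OF radial_rho[OF assms(1)] nz])
  have "rho c (Suc n) \<theta> w * norm (backward (Suc n) \<theta> w) =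
      h (\<beta> * ?r) * (norm w / norm (pull \<theta> w) * norm (backward n (\<gamma>' \<theta>) (pull \<theta> w)))"
    by (simp add: rho_Suc push_def)
  also have "\<dots> \<le> \<beta> * ?r * (norm w / norm (pull \<theta> w) * norm (backward n (\<gamma>' \<theta>) (pull \<theta> w)))"
    using r \<beta>_pos by (intro mult_right_mono h_le) auto
  also have "\<dots> = \<beta> * (norm w / norm (pull \<theta> w)) * (?r * norm (backward n (\<gamma>' \<theta>) (pull \<theta> w)))"
    by simp
  also have "\<dots> \<le> \<beta> * (norm w / norm (pull \<theta> w)) * (c * \<beta> ^ n * norm (pull \<theta> w))"
    using Suc.IH[OF nz] \<beta>_pos by (intro mult_left_mono) auto
  also have "\<dots> = c * \<beta> ^ Suc n * norm w" using nz by simp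
  finally show ?case .
qed simp

text \<open>Up to radius \<open>d\<close> each step gains at least the factor \<open>b\<close>,
  which balances the assumed backward growth. A radius above \<open>d\<close> can be replaced by
  \<open>d\<close>, by monotonicity of \<open>h\<close>.\<close>

lemma rho_lower:
  assumes "0 \<le> c" "0 < b" "0 < d" and d: "\<And>r. 0 \<le> r \<Longrightarrow> r \<le> d \<Longrightarrow> b * r \<le> h (\<beta> * r)"
    and "w \<noteq> 0" "\<And>j. j \<le> n \<Longrightarrow> norm (backward j \<theta> w) \<le> K * b ^ j"
  shows "min c d * norm w \<le> rho c n \<theta> w * K"
  using assms(5,6)
proof (induction n arbitrary: \<theta> w K)
  case 0
  then have "norm w \<le> K" by simp
  then have "min c d * norm w \<le> c * K" using assms by (intro mult_mono) auto
  then show ?case by simp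
next
  case (Suc n)
  define m where "m = min c d"
  define B where "B = pull \<theta> w"
  define r where "r = rho c n (\<gamma>' \<theta>) B"
  have m0: "0 \<le> m" using assms by (simp add: m_def)
  have nz: "B \<noteq> 0" using Suc.prems by (simp add: B_def)
  have r0: "0 \<le> r" unfolding r_def by (rule radial_nonneg[OF radial_rho[OF assms(1)] nz])
  \<comment> \<open>Over the previous base point the hypothesis has the same form, with
    \<open>K * b\<close> in place of \<open>K\<close>.\<close>
  have "norm (backward j (\<gamma>' \<theta>) B) \<le> (K * b) * b ^ j" if "j \<le> n" for j
    using Suc.prems(2)[of "Suc j"] that by (simp add: B_def algebra_simps)
  from Suc.IH[OF nz this] have IH: "m * norm B \<le> r * (K * b)" by (simp add: m_def r_def)
  have B1: "norm B \<le> K * b" using Suc.prems(2)[of 1] by (simp add: B_def)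
  have K0: "0 < K" using Suc.prems(2)[of 0] Suc.prems(1)
    by (metis backward.simps(1) le0 mult.right_neutral power_0 less_le_trans zero_less_norm_iff)
  \<comment> \<open>For \<open>r\<close> at most \<open>d\<close> the linear bound transports the
    induction hypothesis; for larger \<open>r\<close> the bound on \<open>norm B\<close> alone
    suffices.\<close>
  have "m * norm B \<le> h (\<beta> * r) * K"
  proof (cases "r \<le> d")
    case True
    have "r * (K * b) \<le> h (\<beta> * r) * K"
      using mult_right_mono[OF d[OF r0 True], of K] K0 by (simp add: algebra_simps)
    with IH show ?thesis by simp
  next
    case False
    have "m * norm B \<le> d * (K * b)" using B1 m0 assms(3) by (intro mult_mono) (auto simp: m_def)
    also have "\<dots> \<le> h (\<beta> * d) * K"
      using mult_right_mono[OF d[of d], of K] K0 assms(3) by (simp add: algebra_simps)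
    also have "\<dots> \<le> h (\<beta> * r) * K"
      using False r0 assms(3) \<beta>_pos K0 by (intro mult_right_mono) (auto simp: h_le_iff)
    finally show ?thesis .
  qed
  then have "m * norm w * norm B \<le> h (\<beta> * r) * norm w * K"
    using mult_left_mono[of "m * norm B" "h (\<beta> * r) * K" "norm w"] by (simp add: algebra_simps)
  then have "m * norm w \<le> h (\<beta> * r) * norm w * K / norm B"
    using nz by (simp add: pos_le_divide_eq)
  then show ?case by (simp add: rho_Suc push_def m_def B_def r_def)
qed

lemma continuous_on_rho:
  assumes "0 \<le> c" "continuous_on S f" "continuous_on S g" "\<And>x. x \<in> S \<Longrightarrow> g x \<noteq> 0"
  shows "continuous_on S (\<lambda>x. rho c n (f x) (g x))"
  using assms(2-)
proof (induction n arbitrary: f g)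
  case (Suc n)
  have 1: "continuous_on S (\<lambda>x. \<gamma>' (f x))"
    by (rule continuous_on_compose2[OF cont_\<gamma>' Suc.prems(1)]) simp
  have 2: "continuous_on S (\<lambda>x. pull (f x) (g x))"
    by (intro continuous_on_mult_vec continuous_on_adj2 Suc.prems
        continuous_on_compose2[OF cont_A 1]) simp
  have nz: "pull (f x) (g x) \<noteq> 0" if "x \<in> S" for x using Suc.prems(3)[OF that] by simp
  have "continuous_on S (\<lambda>x. \<beta> * rho c n (\<gamma>' (f x)) (pull (f x) (g x)))"
    by (intro continuous_intros Suc.IH[OF 1 2 nz])
  then have "continuous_on S (\<lambda>x. h (\<beta> * rho c n (\<gamma>' (f x)) (pull (f x) (g x))))"
    by (rule continuous_on_compose2[OF cont_h])
      (use \<beta>_pos radial_nonneg[OF radial_rho[OF assms(1)] nz] in auto)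
  then show ?case unfolding rho_Suc push_def
    by (intro continuous_intros 2 Suc.prems) (use nz in auto)
qed simp

end

lemma le_geometric_imp_nonpos:
  fixes x q C :: real
  assumes "\<And>n. x \<le> C * q ^ n" "0 \<le> q" "q < 1"
  shows "x \<le> 0"
proof (rule tendsto_lowerbound)
  show "(\<lambda>n. C * q ^ n) \<longlonglongrightarrow> 0"
    using tendsto_mult_right_zero[OF LIMSEQ_realpow_zero[OF assms(2,3)]] by simp
qed (use assms in auto)

lemma scaled_line_eq_closed_segment:
  fixes u :: "'b::real_vector"
  assumes "0 \<le> r"
  shows "{s *\<^sub>R u |s. \<bar>s\<bar> \<le> r} = closed_segment (- r *\<^sub>R u) (r *\<^sub>R u)"
proof (cases "r = 0")
  case False
  then have r: "0 < r" using assms by simp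
  show ?thesis
  proof (intro equalityI subsetI)
    fix x assume "x \<in> {s *\<^sub>R u |s. \<bar>s\<bar> \<le> r}"
    then obtain s where s: "x = s *\<^sub>R u" "\<bar>s\<bar> \<le> r" by blast
    define t where "t = (s + r) / (2 * r)"
    have "(1 - t) * (- r) + t * r = s" using r by (simp add: t_def field_simps)
    then have "x = (1 - t) *\<^sub>R (- r *\<^sub>R u) + t *\<^sub>R (r *\<^sub>R u)"
      unfolding s by (metis scaleR_add_left scaleR_scaleR)
    moreover have "0 \<le> t" "t \<le> 1" using s r by (auto simp: t_def field_simps)
    ultimately show "x \<in> closed_segment (- r *\<^sub>R u) (r *\<^sub>R u)"
      unfolding closed_segment_def by blast
  next
    fix x assume "x \<in> closed_segment (- r *\<^sub>R u) (r *\<^sub>R u)"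
    then obtain t where t: "x = (1 - t) *\<^sub>R (- r *\<^sub>R u) + t *\<^sub>R (r *\<^sub>R u)" "0 \<le> t" "t \<le> 1"
      unfolding closed_segment_def by blast
    have "x = ((1 - t) * (- r) + t * r) *\<^sub>R u" unfolding t by (metis scaleR_add_left scaleR_scaleR)
    moreover have "\<bar>(1 - t) * (- r) + t * r\<bar> \<le> r"
    proof -
      have "0 \<le> t * r" "t * r \<le> r" using t r by (auto simp: mult_left_le_one_le)
      then show ?thesis by (simp add: algebra_simps abs_le_iff)
    qed
    ultimately show "x \<in> {s *\<^sub>R u |s. \<bar>s\<bar> \<le> r}" by blast
  qed
qed auto

section \<open>The attractor below and between the critical parameters\<close>

context saturated_cocycle
begin

text \<open>\<open>norm w\<close> is at most \<open>rho 1 n\<close>, so \<open>rho_upper\<close>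
  applies and \<open>norm w\<close> cancels.\<close>

lemma attractor_backward_le:
  assumes "w \<noteq> 0" "norm w \<le> envelope \<theta> w"
  shows "norm (backward n \<theta> w) \<le> \<beta> ^ n"
proof -
  have "norm w * norm (backward n \<theta> w) \<le> rho 1 n \<theta> w * norm (backward n \<theta> w)"
    using assms le_envelope_iff by (intro mult_right_mono) auto
  also have "\<dots> \<le> \<beta> ^ n * norm w" using rho_upper[of 1 w n \<theta>] assms by simp
  finally show ?thesis using assms by (simp add: mult.commute)
qed

text \<open>A nonzero attractor point has backward norms at most \<open>\<beta> ^ n\<close>, and the
  forward cocycle recovers it with growth at most \<open>C * exp l ^ n\<close>. The product of the
  two rates is below 1.\<close>

lemma subcritical_attractor:
  assumes "\<beta> < exp (- lyap)"
  shows "attractor \<gamma> A h \<beta> = UNIV \<times> {0}"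
proof -
  have "exp (ln \<beta>) < exp (- lyap)" using assms \<beta>_pos by simp
  then have "lyap < - ln \<beta>" by (subst (asm) exp_less_cancel_iff) simp
  then obtain l where l: "lyap < l" "l < - ln \<beta>" using dense by blast
  have "exp (l + ln \<beta>) < exp 0" using l by (subst exp_less_cancel_iff) simp
  then have q: "exp l * \<beta> < 1" using \<beta>_pos by (simp add: exp_add)
  obtain C where C: "1 \<le> C" "\<And>n \<theta>. matrix_norm (cocycle \<gamma> A n \<theta>) \<le> C * exp l ^ n"
    using uniform_growth[OF l(1)] by blast
  have "w = 0" if w: "(\<theta>, w) \<in> attractor \<gamma> A h \<beta>" for \<theta> w
  proof (rule ccontr)
    assume "w \<noteq> 0"
    with w have b: "norm (backward n \<theta> w) \<le> \<beta> ^ n" for n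
      using attractor_backward_le mem_attractor_iff by blast
    have "norm w \<le> C * (exp l * \<beta>) ^ n" for n
    proof -
      have "norm w \<le> matrix_norm (cocycle \<gamma> A n ((\<gamma>' ^^ n) \<theta>)) * norm (backward n \<theta> w)"
        by (rule norm_le_backward)
      also have "\<dots> \<le> (C * exp l ^ n) * \<beta> ^ n"
        using C b by (intro mult_mono) auto
      finally show ?thesis by (simp add: power_mult_distrib)
    qed
    from le_geometric_imp_nonpos[OF this] q \<beta>_pos have "norm w \<le> 0" by simp
    then show False using \<open>w \<noteq> 0\<close> by simp
  qed
  then show ?thesis by (auto simp: mem_attractor_iff)
qed

lemma intermediate_attractor_fibre:
  assumes "exp (- lyap) < \<beta>" "\<beta> < exp lyap"
  shows "\<exists>\<theta> a b. a \<noteq> b \<and> attractor_fibre \<gamma> A h \<beta> \<theta> = closed_segment a b"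
proof -
  have "- lyap < ln \<beta>" "ln \<beta> < lyap"
    using assms \<beta>_pos by (metis exp_less_cancel_iff exp_ln)+
  then have "\<bar>ln \<beta>\<bar> < lyap" by linarith
  \<comment> \<open>One rate serves both halves: \<open>exp (- k) < \<beta>\<close> makes the radius
    along \<open>u\<close> positive, and \<open>\<beta> < exp k\<close> excludes every other
    direction.\<close>
  then obtain k where k: "\<bar>ln \<beta>\<bar> < k" "k < lyap" using dense by blast
  have "exp (- k) < exp (ln \<beta>)" "exp (ln \<beta>) < exp k"
    using k by (subst exp_less_cancel_iff, linarith)+
  then have k': "exp (- k) < \<beta>" "\<beta> < exp k" using \<beta>_pos by simp_all
  have "0 < k" using k by linarith
  from backward_contraction[OF this k(2)] obtain \<theta> u
    where u: "norm u = 1" "\<And>j. norm (backward j \<theta> u) \<le> exp (- k) ^ j" by blast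
  have u0: "u \<noteq> 0" using u by auto
  obtain d where d: "0 < d" "\<And>r. 0 \<le> r \<Longrightarrow> r \<le> d \<Longrightarrow> exp (- k) * r \<le> h (\<beta> * r)"
    using h_lower_linear[OF k'(1)] by blast
  \<comment> \<open>Here \<open>rho_lower\<close> is used with \<open>c = 1\<close>,
    \<open>b = exp (- k)\<close> and \<open>K = 1\<close>.\<close>
  have "min 1 d * norm u \<le> rho 1 n \<theta> u * 1" for n
    by (rule rho_lower[OF _ _ d u0]) (use u in auto)
  then have "min 1 d \<le> envelope \<theta> u" using u u0 by (simp add: le_envelope_iff)
  moreover define r where "r = envelope \<theta> u"
  ultimately have r: "0 < r" using d by simp
  have "attractor_fibre \<gamma> A h \<beta> \<theta> = {s *\<^sub>R u |s. \<bar>s\<bar> \<le> r}"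
  proof (intro equalityI subsetI)
    fix x assume "x \<in> attractor_fibre \<gamma> A h \<beta> \<theta>"
    then have x: "x = 0 \<or> norm x \<le> envelope \<theta> x" by (simp add: attractor_fibre_def mem_attractor_iff)
    show "x \<in> {s *\<^sub>R u |s. \<bar>s\<bar> \<le> r}"
    proof (cases "x = 0")
      case True
      then show ?thesis using r by (auto intro!: exI[of _ 0])
    next
      case False
      \<comment> \<open>The area spanned with \<open>u\<close> is constant in backward time, while
        the two backward norms are at most \<open>exp (- k) ^ n\<close> and
        \<open>\<beta> ^ n\<close>.\<close>
      have "\<bar>wedge u x\<bar> \<le> 1 * (exp (- k) * \<beta>) ^ n" for n
      proof -
        have "\<bar>wedge u x\<bar> = \<bar>wedge (backward n \<theta> u) (backward n \<theta> x)\<bar>"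
          by (simp add: wedge_backward)
        also have "\<dots> \<le> norm (backward n \<theta> u) * norm (backward n \<theta> x)" by (rule wedge_le)
        also have "\<dots> \<le> exp (- k) ^ n * \<beta> ^ n"
          using u(2) attractor_backward_le False x by (intro mult_mono) auto
        finally show ?thesis by (simp add: power_mult_distrib)
      qed
      moreover have "exp (- k) * \<beta> < 1" using k'(2) by (simp add: exp_minus field_simps)
      ultimately have "\<bar>wedge u x\<bar> \<le> 0"
        using le_geometric_imp_nonpos[of "\<bar>wedge u x\<bar>" 1 "exp (- k) * \<beta>"] \<beta>_pos by simp
      then have xu: "x = (u \<bullet> x) *\<^sub>R u" by (intro wedge_zero_parallel u) simp
      moreover have "u \<bullet> x \<noteq> 0" using xu False by (metis scaleR_zero_left)
      ultimately have "envelope \<theta> x = r" "norm x = \<bar>u \<bullet> x\<bar>"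
        using radial_scaleR[OF radial_envelope, of "u \<bullet> x" \<theta> u] u(1) r_def
        by (metis, metis mult.right_neutral norm_scaleR)
      then show ?thesis using xu x False by auto
    qed
  next
    fix x assume "x \<in> {s *\<^sub>R u |s. \<bar>s\<bar> \<le> r}"
    then obtain s where "x = s *\<^sub>R u" "\<bar>s\<bar> \<le> r" by blast
    then show "x \<in> attractor_fibre \<gamma> A h \<beta> \<theta>"
      by (cases "s = 0")
        (auto simp: attractor_fibre_def mem_attractor_iff radial_scaleR[OF radial_envelope] u r_def)
  qed
  then have "attractor_fibre \<gamma> A h \<beta> \<theta> = closed_segment (- r *\<^sub>R u) (r *\<^sub>R u)"
    using scaled_line_eq_closed_segment[of r u] r by simp
  moreover have "- r *\<^sub>R u \<noteq> r *\<^sub>R u"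
  proof
    assume "- r *\<^sub>R u = r *\<^sub>R u"
    then have "(- r) = r" using u0 scaleR_cancel_right by blast
    then show False using r by simp
  qed
  ultimately show ?thesis by blast
qed

end

section \<open>The attractor above the critical parameters\<close>

locale supercritical_cocycle = saturated_cocycle +
  assumes supercritical: "exp lyap < \<beta>"
begin

section \<open>Uniform bounds and continuity of the radius\<close>

text \<open>For \<open>l\<close> between \<open>lyap\<close> and \<open>ln \<beta>\<close>, every
  direction satisfies the backward growth bound of \<open>rho_lower\<close> with
  \<open>b = exp l\<close> and \<open>K = C * norm w\<close>. The constants \<open>d\<close> and
  \<open>C\<close> depend on none of \<open>c\<close>, \<open>n\<close>, \<theta>,
  \<open>w\<close>.\<close>

lemma uniform_lower_bound:
  obtains d C where "0 < d" "1 \<le> C"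
    "\<And>c n \<theta> w. 0 \<le> c \<Longrightarrow> w \<noteq> 0 \<Longrightarrow> min c d \<le> C * rho c n \<theta> w"
proof -
  have "lyap < ln \<beta>" using supercritical \<beta>_pos by (metis exp_less_cancel_iff exp_ln)
  then obtain l where l: "lyap < l" "l < ln \<beta>" using dense by blast
  have "exp l < exp (ln \<beta>)" using l by (subst exp_less_cancel_iff)
  then have "exp l < \<beta>" using \<beta>_pos by simp
  then obtain d where d: "0 < d" "\<And>r. 0 \<le> r \<Longrightarrow> r \<le> d \<Longrightarrow> exp l * r \<le> h (\<beta> * r)"
    using h_lower_linear by blast
  obtain C where C: "1 \<le> C" "\<And>n \<theta>. matrix_norm (cocycle \<gamma> A n \<theta>) \<le> C * exp l ^ n"
    using uniform_growth[OF l(1)] by blast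
  have "min c d \<le> C * rho c n \<theta> w" if "0 \<le> c" "w \<noteq> 0" for c n \<theta> w
  proof -
    have "min c d * norm w \<le> rho c n \<theta> w * (C * norm w)"
    proof (rule rho_lower[OF that(1) _ d that(2)])
      fix j
      have "norm (backward j \<theta> w) \<le> matrix_norm (cocycle \<gamma> A j ((\<gamma>' ^^ j) \<theta>)) * norm w"
        by (rule norm_backward_le)
      also have "\<dots> \<le> C * exp l ^ j * norm w" by (intro mult_right_mono C) simp
      finally show "norm (backward j \<theta> w) \<le> C * norm w * exp l ^ j" by (simp add: algebra_simps)
    qed simp_all
    then have "min c d * norm w \<le> (C * rho c n \<theta> w) * norm w" by (simp add: algebra_simps)
    then show ?thesis by (rule mult_right_le_imp_le) (use that(2) in simp)
  qed
  with d(1) C(1) show ?thesis by (rule that)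
qed

lemma envelope_lower_bound:
  obtains r where "0 < r" "r \<le> 1" "\<And>\<theta> w. w \<noteq> 0 \<Longrightarrow> r \<le> envelope \<theta> w"
proof -
  obtain d C where d: "0 < d" "1 \<le> C"
    "\<And>c n \<theta> w. 0 \<le> c \<Longrightarrow> w \<noteq> 0 \<Longrightarrow> min c d \<le> C * rho c n \<theta> w"
    using uniform_lower_bound by blast
  have "min 1 d / C \<le> envelope \<theta> w" if "w \<noteq> 0" for \<theta> w
    unfolding le_envelope_iff[OF that]
    using d(3)[of 1 w] that d(2) by (simp add: divide_le_eq mult.commute)
  moreover have "0 < min 1 d / C" "min 1 d / C \<le> 1" using d by (auto simp: divide_le_eq)
  ultimately show ?thesis using that by blast
qed

lemma envelope_pos: "w \<noteq> 0 \<Longrightarrow> 0 < envelope \<theta> w"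
  using envelope_lower_bound by (metis less_le_trans)

text \<open>The quotient \<open>rho 1 n / rho c n\<close> approaches \<open>1\<close> geometrically, since by strict
  concavity \<open>h\<close> contracts quotients of points of a compact subinterval of \<open>{0<..}\<close>.\<close>
lemma rho_diff_geometric:
  assumes "0 < c" "c \<le> 1"
  obtains q where "0 \<le> q" "q < 1"
    "\<And>n \<theta> w. w \<noteq> 0 \<Longrightarrow> rho 1 n \<theta> w - rho c n \<theta> w \<le> (1 / c - 1) * q ^ n"
proof -
  obtain d C where d: "0 < d" "1 \<le> C"
    "\<And>c n \<theta> w. 0 \<le> c \<Longrightarrow> w \<noteq> 0 \<Longrightarrow> min c d \<le> C * rho c n \<theta> w"
    using uniform_lower_bound by blast
  define a where "a = min c d / C"
  have a: "0 < a" using assms d by (simp add: a_def)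
  have lower: "a \<le> rho c n \<theta> w" if "w \<noteq> 0" for n \<theta> w
    using d(3)[of c w n \<theta>] that d(2) assms by (simp add: a_def divide_le_eq mult.commute)
  have upper: "rho c n \<theta> w \<le> rho 1 n \<theta> w" "rho c n \<theta> w \<le> 1" if "w \<noteq> 0" for n \<theta> w
    using rho_mono[of c 1 w n \<theta>] rho_antimono[OF that, of 0 n \<theta>] that assms by auto
  have "a \<le> 1" using lower upper by (metis order_trans axis_eq_0_iff zero_neq_one)
  \<comment> \<open>The interval from \<open>\<beta> * a\<close> to \<beta> contains
    \<open>\<beta> * rho c n \<theta> w\<close> for all \<open>n\<close>, \<theta> and nonzero
    \<open>w\<close>, so one \<open>q\<close> serves every step.\<close>
  then obtain q where q: "0 \<le> q" "q < 1" and contr: "\<And>x y. \<beta> * a \<le> x \<Longrightarrow> x \<le> y \<Longrightarrow> x \<le> \<beta> \<Longrightarrow>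
      h y / h x - 1 \<le> q * (y / x - 1)"
    using h_ratio_contraction[of "\<beta> * a" \<beta>] a \<beta>_pos by auto
  have ratio: "rho 1 n \<theta> w / rho c n \<theta> w - 1 \<le> (1 / c - 1) * q ^ n" if "w \<noteq> 0" for n \<theta> w
    using that
  proof (induction n arbitrary: \<theta> w)
    case (Suc n)
    define B where "B = pull \<theta> w"
    have nz: "B \<noteq> 0" using Suc.prems by (simp add: B_def)
    let ?x = "rho c n (\<gamma>' \<theta>) B" and ?y = "rho 1 n (\<gamma>' \<theta>) B"
    \<comment> \<open>The factor \<open>norm w / norm B\<close> is common to both radii and cancels
      in the quotient.\<close>
    have "rho 1 (Suc n) \<theta> w / rho c (Suc n) \<theta> w - 1 = h (\<beta> * ?y) / h (\<beta> * ?x) - 1"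
      using nz Suc.prems by (simp add: rho_Suc push_def B_def[symmetric])
    also have "\<dots> \<le> q * ((\<beta> * ?y) / (\<beta> * ?x) - 1)"
      using lower[OF nz] upper[OF nz] \<beta>_pos by (intro contr) auto
    also have "\<dots> = q * (?y / ?x - 1)" using \<beta>_pos by simp
    also have "\<dots> \<le> q * ((1 / c - 1) * q ^ n)"
      by (intro mult_left_mono Suc.IH nz q)
    finally show ?case by (simp add: algebra_simps)
  qed simp
  have "rho 1 n \<theta> w - rho c n \<theta> w \<le> (1 / c - 1) * q ^ n" if "w \<noteq> 0" for n \<theta> w
  proof -
    let ?x = "rho c n \<theta> w" and ?y = "rho 1 n \<theta> w"
    have x: "0 < ?x" using lower[OF that] a less_le_trans by blast
    have "?y - ?x = ?x * (?y / ?x - 1)" using x by (simp add: field_simps)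
    also have "\<dots> \<le> 1 * (?y / ?x - 1)"
      using upper[OF that] x by (intro mult_right_mono) auto
    finally show ?thesis using ratio[OF that, of n \<theta>] by simp
  qed
  with q show ?thesis by (rule that)
qed

lemma push_iterate_envelope: "w \<noteq> 0 \<Longrightarrow> (push ^^ n) envelope \<theta> w = envelope \<theta> w"
proof (induction n arbitrary: \<theta> w)
  case (Suc n)
  have "push ((push ^^ n) envelope) \<theta> w = push envelope \<theta> w"
    by (simp only: push_def[of _ \<theta> w] Suc.IH[OF pull_nonzero[OF Suc.prems]])
  then show ?case using push_envelope Suc.prems by simp
qed simp

text \<open>Starting below a function fixed by \<open>push\<close>, the iterates stay below
  it.\<close>

lemma rho_le_envelope:
  assumes "0 \<le> c" "\<And>\<theta> w. w \<noteq> 0 \<Longrightarrow> c \<le> envelope \<theta> w" "w \<noteq> 0"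
  shows "rho c n \<theta> w \<le> envelope \<theta> w"
  using rho_le_rho_shift[OF radial_envelope assms(1,2,3), where n = n and \<theta> = \<theta>]
    push_iterate_envelope[OF assms(3)] by simp

text \<open>With \<open>r\<close> a positive lower bound for the radius, \<open>envelope\<close>
  lies between \<open>rho r n\<close> and \<open>rho 1 n\<close>, whose distance is uniformly
  geometric. It is thus a uniform limit of continuous functions.\<close>

lemma continuous_on_envelope: "continuous_on (UNIV \<times> (- {0})) (\<lambda>p. envelope (fst p) (snd p))"
proof (rule uniform_limit_theorem[where F = sequentially])
  obtain r where r: "0 < r" "r \<le> 1" "\<And>\<theta> w. w \<noteq> 0 \<Longrightarrow> r \<le> envelope \<theta> w"
    using envelope_lower_bound by blast
  obtain q where q: "0 \<le> q" "q < 1"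
    "\<And>n \<theta> w. w \<noteq> 0 \<Longrightarrow> rho 1 n \<theta> w - rho r n \<theta> w \<le> (1 / r - 1) * q ^ n"
    using rho_diff_geometric[OF r(1,2)] by blast
  have est: "dist (rho 1 n \<theta> w) (envelope \<theta> w) \<le> (1 / r - 1) * q ^ n" if "w \<noteq> 0" for n \<theta> w
    using q(3)[OF that, of n \<theta>] envelope_le_rho[OF that, of \<theta> n] rho_le_envelope[OF _ r(3) that, of n \<theta>] r(1)
    by (simp add: dist_real_def)
  show "uniform_limit (UNIV \<times> (- {0})) (\<lambda>n p. rho 1 n (fst p) (snd p))
      (\<lambda>p. envelope (fst p) (snd p)) sequentially"
  proof (rule uniform_limitI)
    fix e :: real assume "0 < e"
    have "(\<lambda>n. (1 / r - 1) * q ^ n) \<longlonglongrightarrow> 0"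
      using tendsto_mult_right_zero[OF LIMSEQ_realpow_zero[OF q(1,2)]] by simp
    from order_tendstoD(2)[OF this \<open>0 < e\<close>]
    show "\<forall>\<^sub>F n in sequentially. \<forall>p\<in>UNIV \<times> (- {0}).
        dist (rho 1 n (fst p) (snd p)) (envelope (fst p) (snd p)) < e"
    proof eventually_elim
      case (elim n)
      then show ?case using est by (auto intro: le_less_trans)
    qed
  qed
  show "\<forall>\<^sub>F n in sequentially. continuous_on (UNIV \<times> (- {0})) (\<lambda>p. rho 1 n (fst p) (snd p))"
    by (intro always_eventually allI continuous_on_rho continuous_intros) auto
qed simp

lemma continuous_on_envelope_compose:
  assumes "continuous_on S f" "continuous_on S g" "\<And>x. x \<in> S \<Longrightarrow> g x \<noteq> 0"
  shows "continuous_on S (\<lambda>x. envelope (f x) (g x))"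
  using continuous_on_compose2[OF continuous_on_envelope continuous_on_Pair[OF assms(1,2)]] assms(3)
  by auto

section \<open>The attractor and its boundary as radial images\<close>

text \<open>A fibrewise radial map taking the unit disk onto the attractor fibre and the unit circle
  onto its boundary. At the zero vector the scalar multiplies 0, whatever its value.\<close>

definition stretch :: "'a \<times> (real^2) \<Rightarrow> 'a \<times> (real^2)" where
  "stretch p = (fst p, envelope (fst p) (snd p) *\<^sub>R snd p)"

text \<open>Off the zero section this follows from continuity of \<open>envelope\<close>; on it,
  from \<open>envelope \<le> 1\<close> for nonzero vectors, which bounds the image by
  \<open>norm (snd p)\<close>.\<close>

lemma continuous_stretch_fibre: "continuous_on UNIV (\<lambda>p. envelope (fst p) (snd p) *\<^sub>R snd p)"
proof (rule continuous_at_imp_continuous_on, rule ballI)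
  fix p :: "'a \<times> (real^2)"
  let ?f = "\<lambda>p. envelope (fst p) (snd p) *\<^sub>R snd p"
  show "isCont ?f p"
  proof (cases "snd p = 0")
    case False
    have "open (UNIV \<times> (- {0}) :: ('a \<times> (real^2)) set)" by (intro open_Times) auto
    moreover have "continuous_on (UNIV \<times> (- {0})) ?f"
      by (intro continuous_intros continuous_on_envelope)
    ultimately show ?thesis
      using False by (cases p) (auto simp: continuous_on_eq_continuous_at)
  next
    case True
    have "norm (?f q) \<le> norm (snd q)" for q
      using envelope_le_1[of "snd q" "fst q"] radial_nonneg[OF radial_envelope, of "snd q" "fst q"]
      by (cases "snd q = 0") (auto simp: mult_left_le_one_le)
    moreover have "(\<lambda>q. norm (snd q)) \<midarrow>p\<rightarrow> 0"
      using isCont_snd[of p "\<lambda>q. q"] True tendsto_norm_zero_iff[of snd "at p"]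
      by (metis continuous_ident isCont_def tendsto_norm_zero_iff)
    ultimately have "?f \<midarrow>p\<rightarrow> 0"
      by (intro Lim_null_comparison[of ?f]) auto
    then show ?thesis using True by (simp add: isCont_def)
  qed
qed

lemma continuous_stretch: "continuous_on UNIV stretch"
  unfolding stretch_def by (intro continuous_intros continuous_stretch_fibre)

text \<open>The set \<open>I\<close> lists the admissible norms: \<open>{..1}\<close> yields the
  attractor and \<open>{1}\<close> the torus.\<close>

lemma stretch_image:
  assumes "\<And>w. 0 < norm w \<Longrightarrow> w \<in> S \<longleftrightarrow> norm w \<in> I"
  shows "stretch ` (UNIV \<times> (S - {0})) = {(\<theta>, w). w \<noteq> 0 \<and> norm w / envelope \<theta> w \<in> I}"
proof (intro equalityI subsetI)
  fix p assume "p \<in> stretch ` (UNIV \<times> (S - {0}))"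
  then obtain \<theta> v where v: "v \<in> S" "v \<noteq> 0" "p = stretch (\<theta>, v)" by auto
  note e = envelope_pos[OF v(2), of \<theta>]
  from e have "envelope \<theta> (envelope \<theta> v *\<^sub>R v) = envelope \<theta> v"
    by (intro radial_scaleR radial_envelope) simp
  with e v assms[of v] show "p \<in> {(\<theta>, w). w \<noteq> 0 \<and> norm w / envelope \<theta> w \<in> I}"
    by (simp add: stretch_def)
next
  fix p assume "p \<in> {(\<theta>, w). w \<noteq> 0 \<and> norm w / envelope \<theta> w \<in> I}"
  then obtain \<theta> w where w: "p = (\<theta>, w)" "w \<noteq> 0" "norm w / envelope \<theta> w \<in> I" by auto
  define v where "v = (1 / envelope \<theta> w) *\<^sub>R w"
  note e = envelope_pos[OF w(2), of \<theta>]
  then have "envelope \<theta> v = envelope \<theta> w" unfolding v_def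
    by (intro radial_scaleR radial_envelope) simp
  with e have "p = stretch (\<theta>, v)" by (simp add: stretch_def w v_def)
  moreover have "v \<noteq> 0" "norm v = norm w / envelope \<theta> w" using e w by (auto simp: v_def)
  moreover from this have "v \<in> S" using assms[of v] w by (simp del: zero_less_norm_iff flip: zero_less_norm_iff[of v])
  ultimately show "p \<in> stretch ` (UNIV \<times> (S - {0}))"
    by (intro image_eqI[of _ _ "(\<theta>, v)"]) auto
qed

lemma attractor_eq_stretch: "attractor \<gamma> A h \<beta> = stretch ` (UNIV \<times> cball 0 1)"
proof -
  have "stretch ` (UNIV \<times> (cball 0 1 - {0})) = {(\<theta>, w). w \<noteq> 0 \<and> norm w / envelope \<theta> w \<in> {..1}}"
    by (rule stretch_image) auto
  also have "\<dots> = {(\<theta>, w). w \<noteq> 0 \<and> norm w \<le> envelope \<theta> w}"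
  proof -
    have "norm w / envelope \<theta> w \<le> 1 \<longleftrightarrow> norm w \<le> envelope \<theta> w" if "w \<noteq> 0" for \<theta> w
      using envelope_pos[OF that, of \<theta>] by (simp add: divide_le_eq)
    then show ?thesis by auto
  qed
  finally have nonzero: "stretch ` (UNIV \<times> (cball 0 1 - {0})) = {(\<theta>, w). w \<noteq> 0 \<and> norm w \<le> envelope \<theta> w}" .
  have zero: "stretch ` (UNIV \<times> {0}) = UNIV \<times> {0}" by (force simp: stretch_def)
  have "stretch ` (UNIV \<times> (cball 0 1 - {0}) \<union> UNIV \<times> {0}) =
      {(\<theta>, w). w \<noteq> 0 \<and> norm w \<le> envelope \<theta> w} \<union> UNIV \<times> {0}"
    unfolding image_Un nonzero zero ..
  moreover have "UNIV \<times> (cball 0 1 - {0}) \<union> UNIV \<times> {0} = (UNIV :: 'a set) \<times> cball (0::real^2) 1" by auto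
  moreover have "attractor \<gamma> A h \<beta> = {(\<theta>, w). w \<noteq> 0 \<and> norm w \<le> envelope \<theta> w} \<union> UNIV \<times> {0}"
    by (auto simp: mem_attractor_iff)
  ultimately show ?thesis by (simp only:)
qed

definition torus :: "('a \<times> (real^2)) set" where
  "torus = shell envelope envelope"

lemma mem_torus_iff: "(\<theta>, w) \<in> torus \<longleftrightarrow> w \<noteq> 0 \<and> norm w = envelope \<theta> w"
  by (auto simp: torus_def shell_def)

lemma compact_attractor: "compact (attractor \<gamma> A h \<beta>)"
  unfolding attractor_eq_stretch
  by (intro compact_continuous_image continuous_on_subset[OF continuous_stretch]
      compact_Times compact_UNIV compact_cball) simp

lemma compact_torus: "compact torus"
proof -
  have "stretch ` (UNIV \<times> (sphere 0 1 - {0})) = {(\<theta>, w). w \<noteq> 0 \<and> norm w / envelope \<theta> w \<in> {1}}"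
    by (rule stretch_image) auto
  also have "\<dots> = torus"
  proof -
    have "norm w / envelope \<theta> w = 1 \<longleftrightarrow> norm w = envelope \<theta> w" if "w \<noteq> 0" for \<theta> w
      using envelope_pos[OF that, of \<theta>] by (simp add: divide_eq_eq)
    then show ?thesis by (auto simp: mem_torus_iff)
  qed
  finally have "torus = stretch ` (UNIV \<times> sphere 0 1)" by simp
  then show ?thesis
    by (simp only:) (intro compact_continuous_image continuous_on_subset[OF continuous_stretch]
      compact_Times compact_UNIV compact_sphere subset_UNIV)
qed

text \<open>The attractor is closed, so its frontier consists of the points that are not interior.
  Continuity of the radius makes points strictly below it interior, and a point on the graph leaves
  the attractor when pushed outward.\<close>

lemma boundary_torus_eq: "boundary_torus \<gamma> A h \<beta> = torus"
proof -
  let ?K = "attractor \<gamma> A h \<beta>"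
  obtain r where r: "0 < r" "r \<le> 1" "\<And>\<theta> w. w \<noteq> 0 \<Longrightarrow> r \<le> envelope \<theta> w"
    using envelope_lower_bound by blast
  have int1: "(\<theta>, w) \<in> interior ?K" if "w = 0 \<or> norm w < envelope \<theta> w" for \<theta> w
  proof (rule interiorI)
    let ?N = "UNIV \<times> (- {0}) :: ('a \<times> (real^2)) set"
    \<comment> \<open>The ball of radius \<open>r\<close> takes care of the zero section, since
      continuity of \<open>envelope\<close> is available only away from it.\<close>
    let ?O = "UNIV \<times> ball 0 r \<union> (?N \<inter> (\<lambda>p. envelope (fst p) (snd p) - norm (snd p)) -` {0<..})"
    show "open ?O"
      by (intro open_Un open_Times continuous_open_preimage continuous_intros
          continuous_on_envelope) auto
    show "(\<theta>, w) \<in> ?O" using that r by auto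
    show "?O \<subseteq> ?K"
    proof
      fix p assume p: "p \<in> ?O"
      obtain \<theta> w where "p = (\<theta>, w)" by (cases p)
      then show "p \<in> ?K" using p r(3)[of w \<theta>] by (cases "w = 0") (auto simp: mem_attractor_iff)
    qed
  qed
  have int2: "(\<theta>, w) \<notin> interior ?K" if "w \<noteq> 0" "norm w = envelope \<theta> w" for \<theta> w
  proof
    assume "(\<theta>, w) \<in> interior ?K"
    then obtain e where e: "0 < e" "ball (\<theta>, w) e \<subseteq> ?K" by (auto simp: mem_interior)
    \<comment> \<open>Scaling \<open>w\<close> by \<open>1 + t\<close> moves it by
      \<open>e / 2\<close>, inside the ball, but beyond the attractor radius.\<close>
    define t where "t = e / (2 * norm w)"
    have t: "0 < t" "t * norm w < e" using e that(1) by (simp_all add: t_def)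
    have "w - (1 + t) *\<^sub>R w = - (t *\<^sub>R w)" by (simp add: algebra_simps)
    then have "dist w ((1 + t) *\<^sub>R w) = t * norm w" using t(1) by (simp add: dist_norm)
    then have "dist (\<theta>, w) (\<theta>, (1 + t) *\<^sub>R w) < e"
      using t by (simp add: dist_Pair_Pair)
    then have "(\<theta>, (1 + t) *\<^sub>R w) \<in> ?K" using e by auto
    moreover have "envelope \<theta> ((1 + t) *\<^sub>R w) = envelope \<theta> w"
      using t by (intro radial_scaleR radial_envelope) simp
    moreover have "(1 + t) *\<^sub>R w \<noteq> 0" "norm ((1 + t) *\<^sub>R w) = (1 + t) * norm w"
      using t(1) that(1) by simp_all
    ultimately have "(1 + t) * norm w \<le> norm w"
      unfolding mem_attractor_iff using that(2) by metis
    then have "t * norm w \<le> 0" by (simp add: algebra_simps)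
    then show False using t(1) that(1) by (simp add: mult_le_0_iff)
  qed
  have "frontier ?K = ?K - interior ?K"
    using compact_imp_closed[OF compact_attractor] by (simp add: frontier_def)
  also have "\<dots> = torus"
  proof (intro equalityI subsetI)
    fix p assume p: "p \<in> ?K - interior ?K"
    obtain \<theta> w where "p = (\<theta>, w)" by (cases p)
    then show "p \<in> torus"
      using p int1[of w \<theta>] by (auto simp only: mem_attractor_iff mem_torus_iff Diff_iff less_le)
  next
    fix p assume p: "p \<in> torus"
    obtain \<theta> w where "p = (\<theta>, w)" by (cases p)
    then show "p \<in> ?K - interior ?K"
      using p int2[of w \<theta>] by (auto simp only: mem_attractor_iff mem_torus_iff Diff_iff order_refl)
  qed
  finally show ?thesis by (simp add: boundary_torus_def)
qed

lemma torus_invariant: "F ` torus = torus"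
proof -
  have "F ` torus = shell (push envelope) (push envelope)"
    unfolding torus_def by (intro skew_product_shell radial_envelope) simp
  also have "\<dots> = torus" by (auto simp: torus_def shell_def push_envelope)
  finally show ?thesis .
qed

text \<open>For \<delta> below the lower bound \<open>r\<close>, the images are the shells between
  \<open>rho \<delta> n\<close> and \<open>rho 1 n\<close>. They all contain the graph of
  \<open>envelope\<close>, and their thickness tends to 0.\<close>

lemma torus_attracts:
  "\<forall>\<^sub>F \<delta> in at_right 0. torus = (\<Inter>n. (F ^^ n) ` (UNIV \<times> (cball 0 1 - ball 0 \<delta>)))"
proof -
  obtain r where r: "0 < r" "r \<le> 1" "\<And>\<theta> w. w \<noteq> 0 \<Longrightarrow> r \<le> envelope \<theta> w"
    using envelope_lower_bound by blast
  have "torus = (\<Inter>n. (F ^^ n) ` (UNIV \<times> (cball 0 1 - ball 0 \<delta>)))" if \<delta>: "0 < \<delta>" "\<delta> < r" for \<delta>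
  proof -
    have "UNIV \<times> (cball 0 1 - ball 0 \<delta>) = shell (\<lambda>_ _. \<delta>) (\<lambda>_ _. 1)"
      using \<delta> by (auto simp: shell_def)
    then have iter: "(F ^^ n) ` (UNIV \<times> (cball 0 1 - ball 0 \<delta>)) = shell (rho \<delta> n) (rho 1 n)" for n
      using iterate_shell[of \<delta> 1 n] \<delta> r by simp
    obtain q where q: "0 \<le> q" "q < 1"
      "\<And>n \<theta> w. w \<noteq> 0 \<Longrightarrow> rho 1 n \<theta> w - rho \<delta> n \<theta> w \<le> (1 / \<delta> - 1) * q ^ n"
      using rho_diff_geometric[of \<delta>] \<delta> r by auto
    have "\<delta> \<le> envelope \<theta> w" if "w \<noteq> 0" for \<theta> w using r(3)[OF that, of \<theta>] \<delta> by simp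
    then have le: "rho \<delta> n \<theta> w \<le> envelope \<theta> w" if "w \<noteq> 0" for n \<theta> w
      using rho_le_envelope \<delta> that by simp
    have eq: "norm w = envelope \<theta> w"
      if w: "w \<noteq> 0" "\<And>n. rho \<delta> n \<theta> w \<le> norm w" "\<And>n. norm w \<le> rho 1 n \<theta> w" for \<theta> w
    proof (rule antisym)
      show "norm w \<le> envelope \<theta> w" using w by (simp add: le_envelope_iff)
      have "envelope \<theta> w - norm w \<le> (1 / \<delta> - 1) * q ^ n" for n
        using q(3)[OF w(1), of n \<theta>] w(2)[of n] envelope_le_rho[OF w(1), of \<theta> n] by linarith
      from le_geometric_imp_nonpos[OF this q(1,2)] show "envelope \<theta> w \<le> norm w" by simp
    qed
    have "(\<theta>, w) \<in> torus \<longleftrightarrow> (\<forall>n. (\<theta>, w) \<in> shell (rho \<delta> n) (rho 1 n))" for \<theta> w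
    proof
      assume "(\<theta>, w) \<in> torus"
      then have "w \<noteq> 0" "norm w = envelope \<theta> w" by (simp_all add: mem_torus_iff)
      then show "\<forall>n. (\<theta>, w) \<in> shell (rho \<delta> n) (rho 1 n)"
        by (simp add: shell_def le envelope_le_rho)
    next
      assume "\<forall>n. (\<theta>, w) \<in> shell (rho \<delta> n) (rho 1 n)"
      then show "(\<theta>, w) \<in> torus"
        unfolding mem_torus_iff using eq[of w \<theta>] by (simp add: shell_def)
    qed
    then show ?thesis unfolding iter by auto
  qed
  then show ?thesis
    unfolding eventually_at_right_field using r(1) by blast
qed

section \<open>Polar coordinates and the topology of the fibres\<close>

lemma norm_unit_vec: "norm (unit_vec \<alpha>) = 1"
  by (rule power2_eq_imp_eq) (simp_all add: norm_sq_2 unit_vec_def)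

lemma unit_vec_nonzero [simp]: "unit_vec \<alpha> \<noteq> 0"
  using norm_unit_vec[of \<alpha>] by auto

text \<open>The admissible radii on a ray fill the interval from 0 to \<open>envelope\<close>, so
  the maximum exists and is the right endpoint.\<close>

lemma radius_eq_envelope: "radius \<gamma> A h \<beta> \<theta> \<alpha> = envelope \<theta> (unit_vec \<alpha>)"
proof -
  have iff: "r *\<^sub>R unit_vec \<alpha> \<in> attractor_fibre \<gamma> A h \<beta> \<theta> \<longleftrightarrow> r \<le> envelope \<theta> (unit_vec \<alpha>)"
    if "0 \<le> r" for r
    using that envelope_pos[of "unit_vec \<alpha>" \<theta>]
    by (cases "r = 0")
      (auto simp: attractor_fibre_def mem_attractor_iff norm_unit_vec radial_scaleR[OF radial_envelope])
  show ?thesis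
    unfolding radius_def
    by (rule Greatest_equality) (use iff envelope_pos[of "unit_vec \<alpha>" \<theta>] in auto)
qed

lemma ex_unit_vec:
  assumes "norm (u :: real^2) = 1"
  obtains \<alpha> where "\<alpha> \<in> {0..<1}" "u = unit_vec \<alpha>"
proof -
  have "(u$1)\<^sup>2 + (u$2)\<^sup>2 = 1" using norm_sq_2[of u] assms by simp
  from sincos_total_2pi[OF this] obtain t where
    t: "0 \<le> t" "t < 2 * pi" "u$1 = cos t" "u$2 = sin t" by blast
  have "u = unit_vec (t / (2 * pi))"
    by (simp add: unit_vec_def vec_eq_iff forall_2 t)
  moreover have "t / (2 * pi) \<in> {0..<1}" using t by simp
  ultimately show ?thesis using that by blast
qed

lemma torus_polar: "torus = {(\<theta>, radius \<gamma> A h \<beta> \<theta> \<alpha> *\<^sub>R unit_vec \<alpha>) | \<theta> \<alpha>. \<alpha> \<in> {0..<1}}"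
proof (intro equalityI subsetI)
  fix p assume "p \<in> torus"
  then obtain \<theta> w where w: "p = (\<theta>, w)" "w \<noteq> 0" "norm w = envelope \<theta> w"
    by (cases p) (auto simp: mem_torus_iff)
  have "norm ((1 / norm w) *\<^sub>R w) = 1" using w(2) by simp
  then obtain \<alpha> where \<alpha>: "\<alpha> \<in> {0..<1}" "(1 / norm w) *\<^sub>R w = unit_vec \<alpha>"
    using ex_unit_vec by blast
  have "envelope \<theta> (unit_vec \<alpha>) = norm w"
    unfolding \<alpha>(2)[symmetric] using w by (subst radial_scaleR[OF radial_envelope]) auto
  moreover have "w = norm w *\<^sub>R ((1 / norm w) *\<^sub>R w)" using w(2) by simp
  ultimately have "w = radius \<gamma> A h \<beta> \<theta> \<alpha> *\<^sub>R unit_vec \<alpha>"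
    unfolding radius_eq_envelope \<alpha>(2) by simp
  then show "p \<in> {(\<theta>, radius \<gamma> A h \<beta> \<theta> \<alpha> *\<^sub>R unit_vec \<alpha>) | \<theta> \<alpha>. \<alpha> \<in> {0..<1}}"
    using w \<alpha> by blast
next
  fix p assume "p \<in> {(\<theta>, radius \<gamma> A h \<beta> \<theta> \<alpha> *\<^sub>R unit_vec \<alpha>) | \<theta> \<alpha>. \<alpha> \<in> {0..<1}}"
  then obtain \<theta> \<alpha> where "p = (\<theta>, envelope \<theta> (unit_vec \<alpha>) *\<^sub>R unit_vec \<alpha>)"
    by (auto simp: radius_eq_envelope)
  then show "p \<in> torus"
    using envelope_pos[of "unit_vec \<alpha>" \<theta>]
    by (simp add: mem_torus_iff norm_unit_vec radial_scaleR[OF radial_envelope])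
qed

lemma continuous_radius: "continuous_on UNIV (\<lambda>(\<theta>, \<alpha>). radius \<gamma> A h \<beta> \<theta> \<alpha>)"
proof -
  have uv: "unit_vec = (\<lambda>\<alpha>. \<chi> i. if i = 1 then cos (2 * pi * \<alpha>) else sin (2 * pi * \<alpha>))"
    by (auto simp: unit_vec_def vec_eq_iff forall_2)
  have "continuous_on UNIV (\<lambda>p::'a \<times> real. unit_vec (snd p))"
    unfolding uv
    apply (intro continuous_on_vec_lambda)
    subgoal for i by (cases "i = 1") (auto intro!: continuous_intros)
    done
  then have "continuous_on UNIV (\<lambda>p::'a \<times> real. envelope (fst p) (unit_vec (snd p)))"
    by (intro continuous_on_envelope_compose continuous_intros) auto
  then show ?thesis by (simp add: radius_eq_envelope case_prod_beta)
qed

text \<open>\<open>stretch\<close> on one fibre is a continuous injection of a compact disk.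
  Injectivity holds because \<open>envelope\<close> depends only on the direction, so the image
  determines the scaling factor.\<close>

lemma attractor_fibre_homeomorphic: "attractor_fibre \<gamma> A h \<beta> \<theta> homeomorphic (cball 0 1 :: (real^2) set)"
proof -
  let ?f = "\<lambda>v. envelope \<theta> v *\<^sub>R v"
  have "continuous_on (cball 0 1) ?f"
    by (rule continuous_on_compose2[OF continuous_stretch_fibre, of _ "\<lambda>v. (\<theta>, v)", simplified])
      (intro continuous_intros)
  moreover have "?f ` cball 0 1 = attractor_fibre \<gamma> A h \<beta> \<theta>"
    unfolding attractor_fibre_def attractor_eq_stretch stretch_def by force
  moreover have "inj_on ?f (cball 0 1)"
  proof (rule inj_onI)
    fix x y assume eq: "?f x = ?f y"
    show "x = y"
    proof (cases "x = 0 \<or> y = 0")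
      case True
      then show ?thesis using eq by (metis envelope_pos less_irrefl scaleR_eq_0_iff)
    next
      case False
      then have e: "0 < envelope \<theta> x" "0 < envelope \<theta> y" using envelope_pos by auto
      then have "envelope \<theta> x = envelope \<theta> (?f x)" "envelope \<theta> y = envelope \<theta> (?f y)"
        by (simp_all add: radial_scaleR[OF radial_envelope])
      then have "envelope \<theta> x = envelope \<theta> y" using eq by simp
      then show ?thesis using eq e by simp
    qed
  qed
  ultimately have "cball (0::real^2) 1 homeomorphic attractor_fibre \<gamma> A h \<beta> \<theta>"
    by (rule homeomorphic_compact[OF compact_cball])
  then show ?thesis by (rule homeomorphic_sym[THEN iffD1])
qed

text \<open>Each point is moved inward along its own ray to the radius \<open>s\<close> allowed over
  \<open>\<theta>'\<close>; the displacement is below \<open>e\<close> because the radii differ by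
  less than \<open>e\<close>.\<close>

lemma fibre_close:
  assumes "\<And>u. norm u = 1 \<Longrightarrow> \<bar>envelope \<theta> u - envelope \<theta>' u\<bar> < e" "0 < e"
  shows "attractor_fibre \<gamma> A h \<beta> \<theta> \<subseteq> (\<Union>x\<in>attractor_fibre \<gamma> A h \<beta> \<theta>'. ball x e)"
proof
  fix x assume x: "x \<in> attractor_fibre \<gamma> A h \<beta> \<theta>"
  show "x \<in> (\<Union>x\<in>attractor_fibre \<gamma> A h \<beta> \<theta>'. ball x e)"
  proof (cases "x = 0")
    case True
    have "0 \<in> attractor_fibre \<gamma> A h \<beta> \<theta>'" by (simp add: attractor_fibre_def mem_attractor_iff)
    moreover have "x \<in> ball 0 e" using True assms(2) by simp
    ultimately show ?thesis by (rule UN_I)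
  next
    case False
    define u where "u = (1 / norm x) *\<^sub>R x"
    have u: "norm u = 1" "u \<noteq> 0" "x = norm x *\<^sub>R u" using False by (auto simp: u_def)
    have "envelope \<theta> x = envelope \<theta> u"
      unfolding u_def using False by (subst radial_scaleR[OF radial_envelope]) auto
    then have nx: "norm x \<le> envelope \<theta> u"
      using x False by (simp add: attractor_fibre_def mem_attractor_iff)
    define s where "s = min (norm x) (envelope \<theta>' u)"
    have s: "0 < s" "s \<le> norm x" "s \<le> envelope \<theta>' u"
      using False envelope_pos[OF u(2), of \<theta>'] by (auto simp: s_def)
    have "norm x - s < e" using nx assms(1)[OF u(1)] assms(2) by (auto simp: s_def min_def)
    then have "norm ((s - norm x) *\<^sub>R u) < e" using s u(1) by simp
    moreover have "(s - norm x) *\<^sub>R u = s *\<^sub>R u - x" using u(3) by (metis scaleR_diff_left)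
    ultimately have "x \<in> ball (s *\<^sub>R u) e" by (simp add: dist_norm)
    moreover have "s *\<^sub>R u \<in> attractor_fibre \<gamma> A h \<beta> \<theta>'"
      using s u by (simp add: attractor_fibre_def mem_attractor_iff radial_scaleR[OF radial_envelope])
    ultimately show ?thesis by blast
  qed
qed

text \<open>Uniform continuity on the compact product of the base and the unit circle controls the
  radii in all directions at once.\<close>

lemma hausdorff_continuous_fibre: "hausdorff_continuous (attractor_fibre \<gamma> A h \<beta>)"
  unfolding hausdorff_continuous_def
proof (intro allI impI)
  fix \<theta> :: 'a and e :: real assume e: "0 < e"
  have "uniformly_continuous_on (UNIV \<times> sphere 0 1) (\<lambda>p. envelope (fst p) (snd p))"
    by (intro compact_uniformly_continuous continuous_on_subset[OF continuous_on_envelope]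
        compact_Times compact_UNIV compact_sphere) auto
  then obtain d where d: "0 < d" "\<And>p q. p \<in> UNIV \<times> sphere 0 1 \<Longrightarrow> q \<in> UNIV \<times> sphere 0 1 \<Longrightarrow>
      dist p q < d \<Longrightarrow> dist (envelope (fst p) (snd p)) (envelope (fst q) (snd q)) < e"
    using e unfolding uniformly_continuous_on_def by (metis dist_commute)
  have close: "\<bar>envelope \<theta>\<^sub>1 u - envelope \<theta>\<^sub>2 u\<bar> < e" if "dist \<theta>\<^sub>1 \<theta>\<^sub>2 < d" "norm u = 1" for \<theta>\<^sub>1 \<theta>\<^sub>2 u
    using d(2)[of "(\<theta>\<^sub>1, u)" "(\<theta>\<^sub>2, u)"] that by (simp add: dist_Pair_Pair dist_real_def)
  have "\<forall>\<^sub>F \<theta>' in at \<theta>. dist \<theta>' \<theta> < d"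
    using d(1) by (auto simp: eventually_at)
  then show "\<forall>\<^sub>F \<theta>' in at \<theta>.
      attractor_fibre \<gamma> A h \<beta> \<theta>' \<subseteq> (\<Union>x\<in>attractor_fibre \<gamma> A h \<beta> \<theta>. ball x e) \<and>
      attractor_fibre \<gamma> A h \<beta> \<theta> \<subseteq> (\<Union>x\<in>attractor_fibre \<gamma> A h \<beta> \<theta>'. ball x e)"
  proof eventually_elim
    case (elim \<theta>')
    then show ?case using close e by (intro conjI fibre_close) (auto simp: dist_commute)
  qed
qed

end

theorem theorem1p1:
  fixes \<gamma> :: "'a::metric_space \<Rightarrow> 'a"
    and A :: "'a \<Rightarrow> real^2^2"
    and h :: "real \<Rightarrow> real"
    and \<beta> \<beta>\<^sub>1 \<beta>\<^sub>2 :: real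
  assumes "compact (UNIV :: 'a set)"
    and "\<exists>\<gamma>'. homeomorphism UNIV UNIV \<gamma> \<gamma>'"
    and "continuous_on UNIV A"
    and "\<forall>\<theta>. det (A \<theta>) = 1"
    and "\<forall>x\<ge>0. h x \<ge> 0"
    and "C2_on {0..} h"
    and "strict_mono_on {0..} h"
    and "strictly_concave_on {0..} h"
    and "bounded (h ` {0..})"
    and "h 0 = 0"
    and "(h has_real_derivative 1) (at 0 within {0..})"
    and "(SUP x\<in>{0..}. h x) \<le> inverse (SUP \<theta>. matrix_norm (A \<theta>))"
    and "\<beta> \<ge> 0"
    and "\<beta>\<^sub>1 = exp (- lyapunov_max \<gamma> A)"
    and "\<beta>\<^sub>2 = exp (lyapunov_max \<gamma> A)"
  shows "(\<beta> < \<beta>\<^sub>1 \<longrightarrow> attractor \<gamma> A h \<beta> = UNIV \<times> {0})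
    \<and> (\<beta>\<^sub>1 < \<beta> \<and> \<beta> < \<beta>\<^sub>2 \<longrightarrow>
        (\<exists>\<theta> a b. a \<noteq> b \<and> attractor_fibre \<gamma> A h \<beta> \<theta> = closed_segment a b))
    \<and> (\<beta>\<^sub>2 < \<beta> \<longrightarrow>
        (\<forall>\<theta>. attractor_fibre \<gamma> A h \<beta> \<theta> homeomorphic (cball 0 1 :: (real^2) set))
        \<and> hausdorff_continuous (attractor_fibre \<gamma> A h \<beta>)
        \<and> (\<forall>\<theta> \<alpha>. 0 < radius \<gamma> A h \<beta> \<theta> \<alpha>)
        \<and> continuous_on UNIV (\<lambda>(\<theta>, \<alpha>). radius \<gamma> A h \<beta> \<theta> \<alpha>)
        \<and> boundary_torus \<gamma> A h \<beta> =
            {(\<theta>, radius \<gamma> A h \<beta> \<theta> \<alpha> *\<^sub>R unit_vec \<alpha>) | \<theta> \<alpha>. \<alpha> \<in> {0..<1}}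
        \<and> compact (boundary_torus \<gamma> A h \<beta>)
        \<and> skew_product \<gamma> A h \<beta> ` boundary_torus \<gamma> A h \<beta> = boundary_torus \<gamma> A h \<beta>
        \<and> (\<forall>\<^sub>F \<delta> in at_right 0. boundary_torus \<gamma> A h \<beta> =
              (\<Inter>n. (skew_product \<gamma> A h \<beta> ^^ n) ` (UNIV \<times> (cball 0 1 - ball 0 \<delta>)))))"
proof -
  obtain \<gamma>' where homeo: "homeomorphism UNIV UNIV \<gamma> \<gamma>'" using assms(2) by blast
  interpret sl2_cocycle \<gamma> \<gamma>' A
    by standard (use assms homeo in auto)
  have cont: "continuous_on {0..} h"
    using assms(6) unfolding C2_on_def by (metis DERIV_continuous_on)
  have h_bound: "h x * bound \<le> 1" if "0 \<le> x" for x
  proof -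
    have "h x \<le> (SUP x\<in>{0..}. h x)"
      using that assms(9) by (intro cSUP_upper bounded_imp_bdd_above) auto
    also have "\<dots> \<le> inverse bound" using assms(12) by (simp add: bound_def)
    finally have "h x * bound \<le> inverse bound * bound"
      using bound_ge_1 by (intro mult_right_mono) auto
    then show ?thesis using bound_ge_1 by simp
  qed
  show ?thesis
  proof (cases "\<beta> = 0")
    \<comment> \<open>For \<beta> = 0 one iterate collapses everything onto the zero section. As
      \<open>\<beta>\<^sub>1\<close> and \<open>\<beta>\<^sub>2\<close> are positive, only the first
      claim is not vacuous.\<close>
    case True
    have zero: "fibre_map A h 0 \<theta> v = 0" for \<theta> v using assms(10) by (simp add: fibre_map_def)
    have "attractor \<gamma> A h \<beta> \<subseteq> (skew_product \<gamma> A h \<beta> ^^ 1) ` (UNIV \<times> cball 0 1)"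
      unfolding attractor_def by blast
    also have "\<dots> \<subseteq> UNIV \<times> {0}" by (auto simp: skew_product_def True zero)
    finally have "attractor \<gamma> A h \<beta> \<subseteq> UNIV \<times> {0}" .
    moreover have "UNIV \<times> {0} \<subseteq> (skew_product \<gamma> A h \<beta> ^^ n) ` (UNIV \<times> cball 0 1)" for n
    proof -
      have "UNIV \<times> {0} = (skew_product \<gamma> A h \<beta> ^^ n) ` (UNIV \<times> {0})"
        by (rule iterate_zero_section[symmetric])
      also have "\<dots> \<subseteq> (skew_product \<gamma> A h \<beta> ^^ n) ` (UNIV \<times> cball 0 1)"
        by (intro image_mono Sigma_mono) auto
      finally show ?thesis .
    qed
    then have "UNIV \<times> {0} \<subseteq> attractor \<gamma> A h \<beta>" unfolding attractor_def by blast
    ultimately have "attractor \<gamma> A h \<beta> = UNIV \<times> {0}" by (rule antisym)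
    moreover have "0 < \<beta>\<^sub>1" "0 < \<beta>\<^sub>2" unfolding assms(14,15) by simp_all
    ultimately show ?thesis using True by simp
  next
    case False
    then interpret saturated_cocycle \<gamma> \<gamma>' A h \<beta>
      by unfold_locales (use assms cont h_bound in auto)
    show ?thesis
    proof (intro conjI impI)
      assume "\<beta> < \<beta>\<^sub>1"
      then show "attractor \<gamma> A h \<beta> = UNIV \<times> {0}" using subcritical_attractor assms(14) by simp
    next
      assume "\<beta>\<^sub>1 < \<beta> \<and> \<beta> < \<beta>\<^sub>2"
      then show "\<exists>\<theta> a b. a \<noteq> b \<and> attractor_fibre \<gamma> A h \<beta> \<theta> = closed_segment a b"
        using intermediate_attractor_fibre assms(14,15) by simp
    next
      assume "\<beta>\<^sub>2 < \<beta>"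
      then interpret supercritical_cocycle \<gamma> \<gamma>' A h \<beta>
        by unfold_locales (use assms(15) in simp)
      show "\<forall>\<theta>. attractor_fibre \<gamma> A h \<beta> \<theta> homeomorphic (cball 0 1 :: (real^2) set)"
        using attractor_fibre_homeomorphic by blast
      show "hausdorff_continuous (attractor_fibre \<gamma> A h \<beta>)"
        by (rule hausdorff_continuous_fibre)
      show "\<forall>\<theta> \<alpha>. 0 < radius \<gamma> A h \<beta> \<theta> \<alpha>"
        by (simp add: radius_eq_envelope envelope_pos)
      show "continuous_on UNIV (\<lambda>(\<theta>, \<alpha>). radius \<gamma> A h \<beta> \<theta> \<alpha>)"
        by (rule continuous_radius)
      show "boundary_torus \<gamma> A h \<beta> =
          {(\<theta>, radius \<gamma> A h \<beta> \<theta> \<alpha> *\<^sub>R unit_vec \<alpha>) | \<theta> \<alpha>. \<alpha> \<in> {0..<1}}"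
        unfolding boundary_torus_eq by (rule torus_polar)
      show "compact (boundary_torus \<gamma> A h \<beta>)"
        unfolding boundary_torus_eq by (rule compact_torus)
      show "skew_product \<gamma> A h \<beta> ` boundary_torus \<gamma> A h \<beta> = boundary_torus \<gamma> A h \<beta>"
        unfolding boundary_torus_eq by (rule torus_invariant)
      show "\<forall>\<^sub>F \<delta> in at_right 0. boundary_torus \<gamma> A h \<beta> =
          (\<Inter>n. (skew_product \<gamma> A h \<beta> ^^ n) ` (UNIV \<times> (cball 0 1 - ball 0 \<delta>)))"
        unfolding boundary_torus_eq by (rule torus_attracts)
    qed
  qed
qed

end
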